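(* Suppose Assumption A holds. Then: (a) Let $k\in I$ and $\bm\pi=(\pi^1,\ldots,\pi^N)\in\bm\Pi_m$ with $\pi^l=\{\phi_n^l\}_{n\ge0}$. The sequence $\{\hat F_n^k(\cdot,\cdot,\bm\pi^{-k})\}_{n\ge0}$ (restricted to $(S_n\setminus D)\times\mathbb{Q}^N$) is the unique solution $\{u_n\}_{n\ge0}$ with $u_n\in\mathscr{U}_n^k$ of $$u_n(i,\bm\lambda)=\sup_{\phi\in\mathscr{P}(A_n^k(i))}T_{n,k}^{[\bm\phi_n^{-k}(\cdot\mid i,\bm\lambda),\phi]}u_{n+1}(i,\bm\lambda)\qquad\text{for all }(i,\bm\lambda)\in(S_n\setminus D)\times\mathbb{Q}^N,\ n\ge0,$$ and there exists $\{\phi_{n*}^k\}_{n\ge0}\in\Pi_m^k$ such that $$\hat F_n^k(i,\bm\lambda,\bm\pi^{-k})=T_{n,k}^{[\bm\phi_n^{-k}(\cdot\mid i,\bm\lambda),\phi_{n*}^k(\cdot\mid i,\bm\lambda)]}\hat F_{n+1}^k(i,\bm\lambda,\bm\pi^{-k})\qquad\text{for all }(i,\bm\lambda)\in(S_n\setminus D)\times\mathbb{Q}^N,\ n\ge0.$$ (b) There exists $\bm\pi_*=(\pi_*^k)_{k\in I}\in\bm\Pi_m$, with $\pi_*^k=\{\psi_{n,*}^k\}_{n\ge0}\in\Pi_m^k$, such that $$F_n^k(i,\bm\lambda,[\bm\pi_*^{-k},\pi_*^k])=\hat F_n^k(i,\bm\lambda,\bm\pi_*^{-k})=\sup_{\phi\in\mathscr{P}(A_n^k(i))}T_{n,k}^{[\bm\psi_{n,*}^{-k}(\cdot\mid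 i,\bm\lambda),\phi]}\hat F_{n+1}^k(i,\bm\lambda,\bm\pi_*^{-k})$$ for all $(i,\bm\lambda)\in(S_n\setminus D)\times\mathbb{Q}^N$, $k\in I$, $n\ge0$. (c) The multipolicy $\bm\pi_*$ in (b) is a Nash equilibrium.
   Context: Game model. $I=\{1,\ldots,N\}$ is a finite set of players and $\mathbb{N}_0=\{0,1,\ldots\}$. For each $n\in\mathbb{N}_0$: $S_n$ is a denumerable state space; $A_n^k$ is the action space of player $k$ and $A_n^k(i)\subseteq A_n^k$ is the finite nonempty set of actions available to player $k$ in state $i\in S_n$; $\bm{A}_n(i)=\prod_{k=1}^N A_n^k(i)$; $p_n(\cdot\mid i,\bm{a})$ is a probability distribution on $S_{n+1}$ for each $i\in S_n$, $\bm{a}\in\bm{A}_n(i)$; $r_n^k(i,\bm{a})\ge 0$ is a rational-valued reward of player $k$, and $\bm{r}_n=(r_n^1,\ldots,r_n^N)$. The target set $D$ is a nonempty subset of $\bigcap_{n}S_n$, and $p_n(D\mid i,\bm a)=\sum_{j\in D}p_n(j\mid i,\bm a)$. Histories: $\mathbb{H}_0=S_0\times\mathbb{Q}^N$, and $\mathbb{H}_n=\{(h_{n-1},\bm{a}_{n-1},i_n,\bm{\lambda}_n): h_{n-1}\in\mathbb{H}_{n-1}$ (with last state $i_{n-1}$), $\bm{a}_{n-1}\in\bm{A}_{n-1}(i_{n-1}),\ i_n\in S_n,\ \bm{\lambda}_n\in\mathbb{Q}^N\}$ for $n\ge1$. Policies: a (randomized history-dependent) policy of player $k$ is a sequence $\pi^k=\{\pi^k_n\}_{n\ge0}$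 of stochastic kernels on $A_n^k$ given $\mathbb{H}_n$ with $\pi_n^k(A_n^k(i_n)\mid h_n)=1$, where $i_n$ is the last state of $h_n$; $\Pi^k$ is the set of these. It is Markov, written $\pi^k=\{\phi_n^k\}_{n\ge 0}$, if $\pi_n^k(\cdot\mid h_n)=\phi_n^k(\cdot\mid i_n,\bm\lambda_n)$ for kernels $\phi_n^k$ on $A_n^k$ given $S_n\times\mathbb{Q}^N$ with $\phi_n^k(A_n^k(i)\mid i,\bm\lambda)=1$; $\Pi_m^k$ is the set of these. $\bm\Pi=\prod_k\Pi^k$, $\bm\Pi_m=\prod_k\Pi_m^k$. A superscript $-k$ denotes the tuple with player $k$'s component removed (e.g. $\bm\pi^{-k}=(\pi^l)_{l\ne k}$, $\bm\phi_n^{-k}=(\phi_n^l)_{l\ne k}$), and $[\bm\pi^{-k},\pi']$, $[\bm\phi_n^{-k},\phi]$ denote the full tuple in which player $k$'s component is $\pi'$, resp. $\phi$. Dynamics: under $\bm\pi\in\bm\Pi$ the process $\{X_n,\bm{\Lambda}_n,Y_n\}_{n\ge0}$ (state, vector of remaining goals $\bm\Lambda_n=(\Lambda_n^1,\ldots,\Lambda_n^N)$, action vector), with $H_n=(X_0,\bm\Lambda_0,Y_0,\ldots,X_n,\bm\Lambda_n)$, evolves as follows: given $H_n=h_n$ the players choose $Y_n=(a^1,\ldots,a^N)$ with probability $\prod_k\pi^k_n(a^k\mid h_n)$; then $\bm\Lambda_{n+1}=\bm\Lambda_n-\bm{r}_n(X_n,Y_n)$ and $X_{n+1}\sim p_n(\cdot\mid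 X_n,Y_n)$. $\mathbb{P}^{\bm\pi}(\cdot\mid H_n=h_n)$, $h_n\in\mathbb{H}_n$, denotes the law of the process continued from time $n$ with history $h_n$ by these rules; $\mathbb{P}^{\bm\pi}_{(i,\bm\lambda)}$ is the law started at time $0$ from $(X_0,\bm\Lambda_0)=(i,\bm\lambda)$; for $\bm\pi\in\bm\Pi_m$, $\mathbb{P}^{\bm\pi}(\cdot\mid X_n=i,\bm\Lambda_n=\bm\lambda)$ is the law of the process started at time $n$ from $(X_n,\bm\Lambda_n)=(i,\bm\lambda)$. $\tau_D^n=\inf\{k\ge n: X_k\in D\}$ ($\inf\emptyset=\infty$), $\tau_D=\tau_D^0$; empty sums are $0$. For $\bm\lambda=(\lambda^1,\ldots,\lambda^N)$: $F_0^k(i,\bm\lambda,\bm\pi)=F^k(i,\bm\lambda,\bm\pi)=\mathbb{P}^{\bm\pi}_{(i,\bm\lambda)}\big(\sum_{t=0}^{\tau_D-1}r_t^k(X_t,Y_t)\ge\lambda^k\big)$ for $\bm\pi\in\bm\Pi$, $(i,\bm\lambda)\in S_0\times\mathbb{Q}^N$; and for $n\ge1$, $\bm\pi\in\bm\Pi_m$, $(i,\bm\lambda)\in S_n\times\mathbb{Q}^N$, $F_n^k(i,\bm\lambda,\bm\pi)=\mathbb{P}^{\bm\pi}\big(\sum_{t=n}^{\tau^n_D-1}r_t^k(X_t,Y_t)\ge\lambda^k\mid X_n=i,\bm\Lambda_n=\bm\lambda\big)$. For $\bm\pi\in\bm\Pi_m$: $\hat F_0^k(i,\bm\lambda,\bm\pi^{-k})=\sup_{\pi^k\in\Pi^k}F_0^k(i,\bm\lambda,[\bm\pi^{-k},\pi^k])$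 (supremum over all history-dependent policies) and, for $n\ge1$, $\hat F_n^k(i,\bm\lambda,\bm\pi^{-k})=\sup_{\pi^k\in\Pi_m^k}F_n^k(i,\bm\lambda,[\bm\pi^{-k},\pi^k])$. $\bm\pi\in\bm\Pi$ is a Nash equilibrium if $F^k(i,\bm\lambda,\bm\pi)=\sup_{\pi'\in\Pi^k}F^k(i,\bm\lambda,[\bm\pi^{-k},\pi'])$ for all $(i,\bm\lambda)\in S_0\times\mathbb{Q}^N$ and $k\in I$. Assumption A: for each $\bm\pi\in\bm\Pi$, $n\ge0$ and $h_n\in\mathbb{H}_n$ whose last state lies in $S_n\setminus D$, $\mathbb{P}^{\bm\pi}(\tau_D^n<\infty\mid H_n=h_n)=1$. $\mathscr{U}_n^k$ is the set of functions $u:(S_n\setminus D)\times\mathbb{Q}^N\to[0,1]$ with $u(i,\bm\lambda)=1$ whenever $\lambda^k<0$. $\mathscr{P}(U)$ is the set of probability measures on $U$. For $u\in\mathscr{U}_{n+1}^k$, $i\in S_n\setminus D$, $\bm\lambda\in\mathbb{Q}^N$, $\bm a\in\bm A_n(i)$ and $\bm\phi=(\phi^1,\ldots,\phi^N)\in\prod_{l=1}^N\mathscr{P}(A_n^l(i))$: $$T_{n,k}^{\bm a}u(i,\bm\lambda)=\mathbb{I}_{[\lambda^k,\infty)}(r_n^k(i,\bm a))\,p_n(D\mid i,\bm a)+\sum_{j\in S_{n+1}\setminus D}u(j,\bm\lambda-\bm r_n(i,\bm a))\,p_n(j\mid i,\bm a),$$ $$T_{n,k}^{\bm\phi}u(i,\bm\lambda)=\sum_{a^1\in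 A_n^1(i)}\cdots\sum_{a^N\in A_n^N(i)}T_{n,k}^{\bm a}u(i,\bm\lambda)\,\phi^1(a^1)\cdots\phi^N(a^N),\qquad \bm a=(a^1,\ldots,a^N).$$ *)

theory Defs
  imports "HOL-Probability.Probability"
begin

section \<open>The game\<close>

text \<open>
  Players are the elements of a finite type \<open>'k\<close>, so that \<open>N = CARD('k)\<close> and \<open>'k \<Rightarrow> rat\<close> is the set
  of goal vectors.  The state spaces and action spaces of all times and players are sets over common
  types \<open>'s\<close> and \<open>'a\<close>.
\<close>

record ('s, 'a, 'k) game =
  states :: "nat \<Rightarrow> 's set"
  actions :: "nat \<Rightarrow> 'k \<Rightarrow> 'a set"
  avail :: "nat \<Rightarrow> 'k \<Rightarrow> 's \<Rightarrow> 'a set"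
  transit :: "nat \<Rightarrow> 's \<Rightarrow> ('k \<Rightarrow> 'a) \<Rightarrow> 's pmf"
  reward :: "nat \<Rightarrow> 'k \<Rightarrow> 's \<Rightarrow> ('k \<Rightarrow> 'a) \<Rightarrow> rat"
  target :: "'s set"

definition joint_avail :: "('s, 'a, 'k) game \<Rightarrow> nat \<Rightarrow> 's \<Rightarrow> ('k \<Rightarrow> 'a) set" where
  "joint_avail G n i = (\<Pi>\<^sub>E k\<in>UNIV. avail G n k i)"

definition valid_game :: "('s, 'a, 'k) game \<Rightarrow> bool" where
  "valid_game G \<longleftrightarrow>
     (\<forall>n. countable (states G n)) \<and>
     target G \<noteq> {} \<and> target G \<subseteq> (\<Inter>n. states G n) \<and>
     (\<forall>n k. \<forall>i\<in>states G n.
        avail G n k i \<subseteq> actions G n k \<and> finite (avail G n k i) \<and> avail G n k i \<noteq> {}) \<and>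
     (\<forall>n. \<forall>i\<in>states G n. \<forall>a\<in>joint_avail G n i.
        set_pmf (transit G n i a) \<subseteq> states G (Suc n) \<and> (\<forall>k. 0 \<le> reward G n k i a))"

section \<open>Histories and policies\<close>

text \<open>
  A history \<open>(past, i, g)\<close> consists of the list of earlier (state, goals, action) triples, oldest
  first, and of the current state \<open>i\<close> and goal vector \<open>g\<close>.
\<close>

type_synonym ('s, 'a, 'k) hist =
  "('s \<times> ('k \<Rightarrow> rat) \<times> ('k \<Rightarrow> 'a)) list \<times> 's \<times> ('k \<Rightarrow> rat)"

definition cur_state :: "('s, 'a, 'k) hist \<Rightarrow> 's" where
  "cur_state h = fst (snd h)"

definition cur_goal :: "('s, 'a, 'k) hist \<Rightarrow> 'k \<Rightarrow> rat" where
  "cur_goal h = snd (snd h)"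

text \<open>Goal vectors in a history are arbitrary; they need not obey the goal dynamics.\<close>

primrec hists :: "('s, 'a, 'k) game \<Rightarrow> nat \<Rightarrow> ('s, 'a, 'k) hist set" where
  "hists G 0 = {([], i, g) | i g. i \<in> states G 0}"
| "hists G (Suc n) =
     {(past @ [(i, g, a)], j, g') | past i g a j g'.
        (past, i, g) \<in> hists G n \<and> a \<in> joint_avail G n i \<and> j \<in> states G (Suc n)}"

type_synonym ('s, 'a, 'k) policy = "nat \<Rightarrow> ('s, 'a, 'k) hist \<Rightarrow> 'a pmf"

type_synonym ('s, 'a, 'k) markov_kernel = "nat \<Rightarrow> 's \<Rightarrow> ('k \<Rightarrow> rat) \<Rightarrow> 'a pmf"

definition probs_on :: "'a set \<Rightarrow> 'a pmf set" where
  "probs_on U = {q. set_pmf q \<subseteq> U}"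

text \<open>
  Since the sets of available actions are finite and the sets of histories are countable, stochastic
  kernels are just families of probability mass functions.  Values at arguments outside
  \<open>hists G n\<close> (outside \<open>states G n\<close> for Markov kernels) are irrelevant and left unconstrained.
\<close>

definition policies :: "('s, 'a, 'k) game \<Rightarrow> 'k \<Rightarrow> ('s, 'a, 'k) policy set" where
  "policies G k = {\<pi>. \<forall>n. \<forall>h\<in>hists G n. \<pi> n h \<in> probs_on (avail G n k (cur_state h))}"

definition markov_kernels :: "('s, 'a, 'k) game \<Rightarrow> 'k \<Rightarrow> ('s, 'a, 'k) markov_kernel set" where
  "markov_kernels G k = {\<phi>. \<forall>n. \<forall>i\<in>states G n. \<forall>g. \<phi> n i g \<in> probs_on (avail G n k i)}"

definition markov :: "('s, 'a, 'k) markov_kernel \<Rightarrow> ('s, 'a, 'k) policy" where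
  "markov \<phi> n h = \<phi> n (cur_state h) (cur_goal h)"

definition markov_policies :: "('s, 'a, 'k) game \<Rightarrow> 'k \<Rightarrow> ('s, 'a, 'k) policy set" where
  "markov_policies G k = markov ` markov_kernels G k"

definition multipolicies :: "('s, 'a, 'k) game \<Rightarrow> ('k \<Rightarrow> ('s, 'a, 'k) policy) set" where
  "multipolicies G = {\<pi>. \<forall>k. \<pi> k \<in> policies G k}"

section \<open>The law of the process\<close>

text \<open>
  The trajectory law of an inhomogeneous Markov chain with discrete transitions, by the
  Ionescu-Tulcea construction.  The kernels look only at the preceding coordinate, so they are
  measurable without any countability assumption on the type of coordinates.
\<close>

definition chain_kernel ::
    "'x pmf \<Rightarrow> (nat \<Rightarrow> 'x \<Rightarrow> 'x pmf) \<Rightarrow> nat \<Rightarrow> (nat \<Rightarrow> 'x) \<Rightarrow> 'x measure" where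
  "chain_kernel \<mu> K t \<omega> = measure_pmf (case t of 0 \<Rightarrow> \<mu> | Suc s \<Rightarrow> K s (\<omega> s))"

lemma chain_kernel_measurable:
  "chain_kernel \<mu> K t \<in> PiM {0..<t} (\<lambda>_. count_space UNIV) \<rightarrow>\<^sub>M subprob_algebra (count_space UNIV)"
proof (cases t)
  case 0
  then show ?thesis
    by (simp add: chain_kernel_def[abs_def] measure_pmf_in_subprob_algebra)
next
  case (Suc s)
  have "(\<lambda>\<omega>. \<omega> s) \<in> PiM {0..<t} (\<lambda>_. count_space UNIV) \<rightarrow>\<^sub>M count_space UNIV"
    using Suc by (intro measurable_component_singleton) simp
  moreover have "(\<lambda>x. measure_pmf (K s x)) \<in> count_space UNIV \<rightarrow>\<^sub>M subprob_algebra (count_space UNIV)"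
    by (simp add: measure_pmf_in_subprob_algebra)
  ultimately show ?thesis
    unfolding chain_kernel_def[abs_def] Suc nat.case by (rule measurable_compose)
qed

interpretation chain: Ionescu_Tulcea "chain_kernel \<mu> K" "\<lambda>_. count_space UNIV" for \<mu> K
  by (rule Ionescu_Tulcea.intro)
    (rule chain_kernel_measurable, simp add: chain_kernel_def prob_space_measure_pmf)

definition chain_law :: "'x pmf \<Rightarrow> (nat \<Rightarrow> 'x \<Rightarrow> 'x pmf) \<Rightarrow> (nat \<Rightarrow> 'x) measure" where
  "chain_law \<mu> K = chain.PF.lim \<mu> K"

lemma prob_space_chain_law: "prob_space (chain_law \<mu> K)"
proof
  have "emeasure (chain.PF.lim \<mu> K)
          (prod_emb UNIV (\<lambda>_. count_space UNIV) {} (space (PiM {} (\<lambda>_. count_space UNIV)))) =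
        emeasure (chain.CI \<mu> K {}) (space (chain.CI \<mu> K {}))"
    by (subst chain.lim) (auto simp: chain.PF.space_P)
  also have "\<dots> = 1"
    by (rule prob_space.emeasure_space_1) (simp add: chain.PF.prob_space_P)
  finally show "emeasure (chain_law \<mu> K) (space (chain_law \<mu> K)) = 1"
    by (simp add: chain_law_def prod_emb_def space_PiM restrict_def vimage_def)
qed

text \<open>
  The process restarted at time \<open>n\<close> is the chain of pairs \<open>(H\<^sub>t, Y\<^sub>t)\<close>, \<open>t \<ge> n\<close>; coordinate \<open>m\<close> of a
  trajectory belongs to time \<open>n + m\<close>.
\<close>

definition decide ::
    "('k::finite \<Rightarrow> ('s, 'a, 'k) policy) \<Rightarrow> nat \<Rightarrow> ('s, 'a, 'k) hist
       \<Rightarrow> (('s, 'a, 'k) hist \<times> ('k \<Rightarrow> 'a)) pmf" where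
  "decide \<pi> n h = map_pmf (Pair h) (Pi_pmf UNIV undefined (\<lambda>k. \<pi> k n h))"

fun extend_hist ::
    "('s, 'a, 'k) game \<Rightarrow> nat \<Rightarrow> ('s, 'a, 'k) hist \<Rightarrow> ('k \<Rightarrow> 'a) \<Rightarrow> 's \<Rightarrow> ('s, 'a, 'k) hist" where
  "extend_hist G n (past, i, g) a j = (past @ [(i, g, a)], j, \<lambda>k. g k - reward G n k i a)"

fun step ::
    "('s, 'a, 'k::finite) game \<Rightarrow> ('k \<Rightarrow> ('s, 'a, 'k) policy) \<Rightarrow> nat
       \<Rightarrow> ('s, 'a, 'k) hist \<times> ('k \<Rightarrow> 'a) \<Rightarrow> (('s, 'a, 'k) hist \<times> ('k \<Rightarrow> 'a)) pmf" where
  "step G \<pi> n (h, a) =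
     bind_pmf (transit G n (cur_state h) a) (\<lambda>j. decide \<pi> (Suc n) (extend_hist G n h a j))"

definition law ::
    "('s, 'a, 'k::finite) game \<Rightarrow> ('k \<Rightarrow> ('s, 'a, 'k) policy) \<Rightarrow> nat \<Rightarrow> ('s, 'a, 'k) hist
       \<Rightarrow> (nat \<Rightarrow> ('s, 'a, 'k) hist \<times> ('k \<Rightarrow> 'a)) measure" where
  "law G \<pi> n h = chain_law (decide \<pi> n h) (\<lambda>m. step G \<pi> (n + m))"

text \<open>State and action vector at the absolute time \<open>t \<ge> n\<close> of a trajectory started at time \<open>n\<close>.\<close>

definition state_at :: "nat \<Rightarrow> (nat \<Rightarrow> ('s, 'a, 'k) hist \<times> ('k \<Rightarrow> 'a)) \<Rightarrow> nat \<Rightarrow> 's" where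
  "state_at n \<omega> t = cur_state (fst (\<omega> (t - n)))"

definition act_at :: "nat \<Rightarrow> (nat \<Rightarrow> ('s, 'a, 'k) hist \<times> ('k \<Rightarrow> 'a)) \<Rightarrow> nat \<Rightarrow> 'k \<Rightarrow> 'a" where
  "act_at n \<omega> t = snd (\<omega> (t - n))"

definition hit_time ::
    "('s, 'a, 'k) game \<Rightarrow> nat \<Rightarrow> (nat \<Rightarrow> ('s, 'a, 'k) hist \<times> ('k \<Rightarrow> 'a)) \<Rightarrow> enat" where
  "hit_time G n \<omega> = Inf (enat ` {t. n \<le> t \<and> state_at n \<omega> t \<in> target G})"

text \<open>
  The total reward before the target is hit, possibly \<open>\<infinity>\<close>.  Rewards of available actions are
  nonnegative, so \<open>ennreal\<close> truncates nothing on trajectories of positive probability.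
\<close>

definition gain ::
    "('s, 'a, 'k) game \<Rightarrow> nat \<Rightarrow> 'k \<Rightarrow> (nat \<Rightarrow> ('s, 'a, 'k) hist \<times> ('k \<Rightarrow> 'a)) \<Rightarrow> ennreal" where
  "gain G n k \<omega> =
     (\<Sum>t. if n \<le> t \<and> enat t < hit_time G n \<omega>
          then ennreal (of_rat (reward G t k (state_at n \<omega> t) (act_at n \<omega> t))) else 0)"

definition assumption_A :: "('s, 'a, 'k::finite) game \<Rightarrow> bool" where
  "assumption_A G \<longleftrightarrow>
     (\<forall>\<pi>\<in>multipolicies G. \<forall>n. \<forall>h\<in>hists G n. cur_state h \<notin> target G \<longrightarrow>
        \<P>(\<omega> in law G \<pi> n h. hit_time G n \<omega> < \<infinity>) = 1)"

section \<open>Performance functions and equilibria\<close>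

text \<open>
  For \<open>n = 0\<close> the start \<open>([], i, g)\<close> is a history in \<open>hists G 0\<close> and \<open>\<pi>\<close> may be any multipolicy.
  For \<open>n \<ge> 1\<close> the function is meant for Markov \<open>\<pi>\<close> only: these depend on the current state and goals
  alone, so the process started at time \<open>n\<close> from \<open>(i, g)\<close> is the one with the empty record of the past.
\<close>

definition F ::
    "('s, 'a, 'k::finite) game \<Rightarrow> nat \<Rightarrow> 'k \<Rightarrow> 's \<Rightarrow> ('k \<Rightarrow> rat)
       \<Rightarrow> ('k \<Rightarrow> ('s, 'a, 'k) policy) \<Rightarrow> real" where
  "F G n k i g \<pi> =
     \<P>(\<omega> in law G \<pi> n ([], i, g). ereal (of_rat (g k)) \<le> enn2ereal (gain G n k \<omega>))"

text \<open>The component \<open>\<pi> k\<close> is overwritten, so this depends only on the other players' policies.\<close>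

definition Fhat ::
    "('s, 'a, 'k::finite) game \<Rightarrow> nat \<Rightarrow> 'k \<Rightarrow> 's \<Rightarrow> ('k \<Rightarrow> rat)
       \<Rightarrow> ('k \<Rightarrow> ('s, 'a, 'k) policy) \<Rightarrow> real" where
  "Fhat G n k i g \<pi> =
     (if n = 0 then (SUP \<pi>'\<in>policies G k. F G 0 k i g (\<pi>(k := \<pi>')))
      else (SUP \<pi>'\<in>markov_policies G k. F G n k i g (\<pi>(k := \<pi>'))))"

definition nash_equilibrium ::
    "('s, 'a, 'k::finite) game \<Rightarrow> ('k \<Rightarrow> ('s, 'a, 'k) policy) \<Rightarrow> bool" where
  "nash_equilibrium G \<pi> \<longleftrightarrow> \<pi> \<in> multipolicies G \<and>
     (\<forall>i\<in>states G 0. \<forall>g k.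
        F G 0 k i g \<pi> = (SUP \<pi>'\<in>policies G k. F G 0 k i g (\<pi>(k := \<pi>'))))"

section \<open>Optimality equations\<close>

definition \<U> :: "('s, 'a, 'k) game \<Rightarrow> nat \<Rightarrow> 'k \<Rightarrow> ('s \<Rightarrow> ('k \<Rightarrow> rat) \<Rightarrow> real) set" where
  "\<U> G n k = {u. \<forall>i\<in>states G n - target G. \<forall>g.
     u i g \<in> {0..1} \<and> (g k < 0 \<longrightarrow> u i g = 1)}"

definition T_act ::
    "('s, 'a, 'k) game \<Rightarrow> nat \<Rightarrow> 'k \<Rightarrow> ('k \<Rightarrow> 'a) \<Rightarrow> ('s \<Rightarrow> ('k \<Rightarrow> rat) \<Rightarrow> real)
       \<Rightarrow> 's \<Rightarrow> ('k \<Rightarrow> rat) \<Rightarrow> real" where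
  "T_act G n k a u i g =
     indicator {g k..} (reward G n k i a) * measure_pmf.prob (transit G n i a) (target G) +
     (\<Sum>\<^sub>\<infinity>j\<in>states G (Suc n) - target G.
        u j (\<lambda>l. g l - reward G n l i a) * pmf (transit G n i a) j)"

definition T_mix ::
    "('s, 'a, 'k::finite) game \<Rightarrow> nat \<Rightarrow> 'k \<Rightarrow> ('k \<Rightarrow> 'a pmf) \<Rightarrow> ('s \<Rightarrow> ('k \<Rightarrow> rat) \<Rightarrow> real)
       \<Rightarrow> 's \<Rightarrow> ('k \<Rightarrow> rat) \<Rightarrow> real" where
  "T_mix G n k q u i g =
     (\<Sum>a\<in>joint_avail G n i. T_act G n k a u i g * (\<Prod>l\<in>UNIV. pmf (q l) (a l)))"

definition optimality_solution ::
    "('s, 'a, 'k::finite) game \<Rightarrow> 'k \<Rightarrow> ('k \<Rightarrow> ('s, 'a, 'k) markov_kernel)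
       \<Rightarrow> (nat \<Rightarrow> 's \<Rightarrow> ('k \<Rightarrow> rat) \<Rightarrow> real) \<Rightarrow> bool" where
  "optimality_solution G k \<phi> u \<longleftrightarrow>
     (\<forall>n. u n \<in> \<U> G n k) \<and>
     (\<forall>n. \<forall>i\<in>states G n - target G. \<forall>g.
        u n i g = (SUP q\<in>probs_on (avail G n k i).
                     T_mix G n k ((\<lambda>l. \<phi> l n i g)(k := q)) (u (Suc n)) i g))"

definition mutual_best_response ::
    "('s, 'a, 'k::finite) game \<Rightarrow> ('k \<Rightarrow> ('s, 'a, 'k) markov_kernel) \<Rightarrow> bool" where
  "mutual_best_response G \<psi> \<longleftrightarrow>
     (\<forall>n k. \<forall>i\<in>states G n - target G. \<forall>g.
        F G n k i g (\<lambda>l. markov (\<psi> l)) = Fhat G n k i g (\<lambda>l. markov (\<psi> l)) \<and>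
        Fhat G n k i g (\<lambda>l. markov (\<psi> l)) =
          (SUP q\<in>probs_on (avail G n k i).
             T_mix G n k ((\<lambda>l. \<psi> l n i g)(k := q))
               (\<lambda>j g'. Fhat G (Suc n) k j g' (\<lambda>l. markov (\<psi> l))) i g))"

end

theory Submission
  imports Defs
begin

text \<open>
  A dynamic programming argument reduces everything to one fixed point.  Fix the Markov policies of the
  players other than \<open>k\<close>.  Conditioning on the first action and the first transition shows that the
  winning probability of \<open>k\<close> satisfies a one-step recursion (\<open>win_prob_first_step\<close>) whose right-hand side
  is given by \<open>T_mix\<close> (\<open>T_mix_eq_next_expectation\<close>); the probability of avoiding the target for \<open>m\<close> more steps satisfies the same recursion
  without the reward (\<open>survival_Suc\<close>).  Hence a \<open>[0,1]\<close>-valued function that satisfies the optimality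
  inequality in one direction differs in that direction from the winning probability by at most the
  \<open>m\<close>-step survival probability, for every \<open>m\<close>, and Assumption A sends this error to \<open>0\<close>
  (\<open>win_prob_le_supersolution\<close>, \<open>subsolution_le_win_prob\<close>).  So every solution of the optimality equation
  dominates the value of every policy, history dependent or not, and is attained by the Markov policy
  that picks maximising actions: a solution can only be the optimal value function \<open>Fhat\<close>
  (\<open>solution_eq_Fhat\<close>), which gives uniqueness and the optimal policy.
  
  Existence, both of a solution of the optimality equation and of an equilibrium, comes from
  \<open>ex_equilibrium_values\<close>.  There the unknowns are the mixed actions of a set \<open>C\<close> of players and the value
  functions of all players, at all times, states and goal vectors simultaneously.  These are countably
  many numbers in \<open>[0,1]\<close>, i.e. a point of the Hilbert cube.  Nash's map on the mixed actions, together
  with the one-step evaluation on the values, is a self-map of the cube that is continuous for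
  coordinatewise convergence, so it has a fixed point (\<open>countable_cube_fixed_point\<close>, a consequence of
  Kuhn's combinatorial lemma).  At a fixed point the values are consistent with the mixed actions and no
  player in \<open>C\<close> gains by a one-step deviation, i.e. the values solve the optimality equation of each such
  player against the others.  With \<open>C = {k}\<close> this yields the solution of the optimality equation of player \<open>k\<close>
  against given opponents, with all players in \<open>C\<close> it yields mutual best responses; read at time \<open>0\<close>,
  where \<open>Fhat\<close> is a supremum over all policies, the latter form a Nash equilibrium.
\<close>

section \<open>A fixed point theorem for countable powers of the unit interval\<close>

lemma cube_convergent_subsequence:
  fixes X :: "nat \<Rightarrow> nat \<Rightarrow> real"
  assumes "\<And>m j. X m j \<in> {0..1}"
  shows "\<exists>x r. strict_mono r \<and> (\<forall>j. x j \<in> {0..1}) \<and> (\<forall>j. (\<lambda>m. X (r m) j) \<longlonglongrightarrow> x j)"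
proof -
  have "compactin (product_topology (\<lambda>_. euclidean) UNIV) (PiE UNIV (\<lambda>_::nat. {0..1::real}))"
    by (simp add: compactin_PiE compactin_euclidean_iff)
  then have "compact (PiE UNIV (\<lambda>_::nat. {0..1::real}))"
    by (simp add: euclidean_product_topology)
  then have "seq_compact (PiE UNIV (\<lambda>_::nat. {0..1::real}))"
    by (simp add: compact_eq_seq_compact_metric)
  moreover have "\<forall>m. X m \<in> PiE UNIV (\<lambda>_::nat. {0..1::real})"
    using assms by (auto simp: PiE_iff)
  ultimately obtain x r where "x \<in> PiE UNIV (\<lambda>_::nat. {0..1::real})" "strict_mono r" and *: "(X \<circ> r) \<longlonglongrightarrow> x"
    by (rule seq_compactE)
  moreover have "(\<lambda>m. X (r m) j) \<longlonglongrightarrow> x j" for j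
    using continuous_on_tendsto_compose[OF continuous_on_product_coordinates * UNIV_I] by (simp add: o_def)
  ultimately show ?thesis by (intro exI[of _ x] exI[of _ r]) (auto simp: PiE_iff)
qed

text \<open>
  Kuhn's lemma on the grid of mesh \<open>1 / (n + 1)\<close> in the first \<open>n\<close> coordinates, where a grid point has label
  \<open>0\<close> in direction \<open>i\<close> if the map does not decrease its \<open>i\<close>-th coordinate.  A cell in which both labels
  occur in each direction contains, for each \<open>i < n\<close>, a point that is not moved down and one
  that is not moved up in direction \<open>i\<close>.  The remaining coordinates are set to \<open>0\<close>.
\<close>

lemma near_fixed_point:
  fixes f :: "(nat \<Rightarrow> real) \<Rightarrow> nat \<Rightarrow> real"
  assumes maps: "\<And>x j. (\<And>j. x j \<in> {0..1}) \<Longrightarrow> f x j \<in> {0..1}"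
  shows "\<exists>x. (\<forall>j. x j \<in> {0..1}) \<and> (\<forall>i<n. \<exists>y z. (\<forall>j. y j \<in> {0..1} \<and> z j \<in> {0..1} \<and>
    \<bar>y j - x j\<bar> \<le> 1 / real (Suc n) \<and> \<bar>z j - x j\<bar> \<le> 1 / real (Suc n)) \<and> y i \<le> f y i \<and> f z i \<le> z i)"
proof -
  define p where "p = Suc n"
  define pt where "pt x = (\<lambda>j. if j < n then real (x j) / real p else 0)" for x :: "nat \<Rightarrow> nat"
  have pt: "pt x j \<in> {0..1}" if "\<forall>i<n. x i \<le> p" for x j
    using that by (auto simp: pt_def p_def)
  \<comment> \<open>The test \<open>x i < p\<close> enforces label \<open>1\<close> on the upper face, also where the map leaves the coordinate unchanged.\<close>
  define lab where "lab x i = (if x i < p \<and> pt x i \<le> f (pt x) i then 0 else 1::nat)" for x i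
  have "0 < p" by (simp add: p_def)
  moreover have "\<forall>x. (\<forall>i<n. x i \<le> p) \<longrightarrow> (\<forall>i<n. lab x i = (0::nat) \<or> lab x i = 1)"
    by (auto simp: lab_def)
  moreover have "\<forall>x. (\<forall>i<n. x i \<le> p) \<longrightarrow> (\<forall>i<n. x i = 0 \<longrightarrow> lab x i = 0)"
  proof (intro allI impI)
    fix x i assume x: "\<forall>i<n. x i \<le> p" "i < n" "x i = 0"
    then have "pt x i = 0" by (simp add: pt_def)
    moreover have "f (pt x) i \<in> {0..1}" by (rule maps) (rule pt[OF x(1)])
    ultimately show "lab x i = 0" using \<open>0 < p\<close> x(3) by (simp add: lab_def)
  qed
  moreover have "\<forall>x. (\<forall>i<n. x i \<le> p) \<longrightarrow> (\<forall>i<n. x i = p \<longrightarrow> lab x i = 1)"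
    by (auto simp: lab_def)
  ultimately obtain q where q: "\<forall>i<n. q i < p" and
    rs: "\<forall>i<n. \<exists>r s. (\<forall>j<n. q j \<le> r j \<and> r j \<le> q j + 1) \<and> (\<forall>j<n. q j \<le> s j \<and> s j \<le> q j + 1) \<and> lab r i \<noteq> lab s i"
    by (rule kuhn_lemma)
  have near: "\<bar>pt r j - pt q j\<bar> \<le> 1 / real (Suc n)" if "\<forall>j<n. q j \<le> r j \<and> r j \<le> q j + 1" for r j
  proof (cases "j < n")
    case True
    have "real (r j) \<le> real (q j) + 1" "real (q j) \<le> real (r j)"
      using that True by (auto simp: of_nat_Suc[symmetric] simp del: of_nat_Suc)
    then have "\<bar>real (r j) - real (q j)\<bar> / real p \<le> 1 / real p"
      by (intro divide_right_mono) auto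
    then show ?thesis
      using True by (auto simp: pt_def p_def diff_divide_distrib[symmetric])
  qed (auto simp: pt_def)
  have lo: "pt r i \<le> f (pt r) i" if "lab r i = 0" for r i
    using that by (auto simp: lab_def split: if_splits)
  have hi: "f (pt r) i \<le> pt r i" if "\<forall>i<n. r i \<le> p" "lab r i \<noteq> 0" "i < n" for r i
  proof (cases "r i = p")
    case True
    then have "pt r i = 1" using that by (auto simp: pt_def p_def)
    moreover have "f (pt r) i \<in> {0..1}" by (rule maps) (rule pt[OF that(1)])
    ultimately show ?thesis by simp
  next
    case False
    then have "r i < p" using that by (simp add: order.not_eq_order_implies_strict)
    then show ?thesis using that(2) by (auto simp: lab_def split: if_splits)
  qed
  show ?thesis
  proof (rule exI[of _ "pt q"], intro conjI allI impI)
    show "pt q j \<in> {0..1}" for j using q by (intro pt) (auto intro: less_imp_le)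
    fix i assume i: "i < n"
    then obtain r s where r: "\<forall>j<n. q j \<le> r j \<and> r j \<le> q j + 1" and s: "\<forall>j<n. q j \<le> s j \<and> s j \<le> q j + 1"
      and "lab r i \<noteq> lab s i" using rs by blast
    then obtain y z where y: "\<forall>j<n. q j \<le> y j \<and> y j \<le> q j + 1" "lab y i = 0"
      and z: "\<forall>j<n. q j \<le> z j \<and> z j \<le> q j + 1" "lab z i \<noteq> 0"
    proof (cases "lab r i = 0")
      case True
      with \<open>lab r i \<noteq> lab s i\<close> have "lab s i \<noteq> 0" by simp
      from that[OF r True s this] show ?thesis .
    next
      case False
      with \<open>lab r i \<noteq> lab s i\<close> have "lab s i = 0" by (auto simp: lab_def split: if_splits)
      from that[OF s this r False] show ?thesis .
    qed
    have le: "\<forall>j<n. y j \<le> p" "\<forall>j<n. z j \<le> p"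
      using q y(1) z(1) by (fastforce intro: le_trans)+
    show "\<exists>y z. (\<forall>j. y j \<in> {0..1} \<and> z j \<in> {0..1} \<and>
        \<bar>y j - pt q j\<bar> \<le> 1 / real (Suc n) \<and> \<bar>z j - pt q j\<bar> \<le> 1 / real (Suc n)) \<and> y i \<le> f y i \<and> f z i \<le> z i"
      by (intro exI[of _ "pt y"] exI[of _ "pt z"] conjI allI pt[OF le(1)] pt[OF le(2)]
          near[OF y(1)] near[OF z(1)] lo[OF y(2)] hi[OF le(2) z(2) i])
  qed
qed

text \<open>
  A limit point of the cells for \<open>n \<rightarrow> \<infinity>\<close> is fixed: for every \<open>i\<close> it is a limit both of points that
  are not moved down and of points that are not moved up in direction \<open>i\<close>.  The dimension grows along
  with the refinement of the grid, so that a single passage to the limit takes care of both.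
\<close>

lemma hilbert_cube_fixed_point:
  fixes f :: "(nat \<Rightarrow> real) \<Rightarrow> nat \<Rightarrow> real"
  assumes maps: "\<And>x j. (\<And>j. x j \<in> {0..1}) \<Longrightarrow> f x j \<in> {0..1}"
    and cont: "\<And>X x j. (\<And>m j. X m j \<in> {0..1}) \<Longrightarrow> (\<And>j. x j \<in> {0..1}) \<Longrightarrow>
      (\<And>j. (\<lambda>m. X m j) \<longlonglongrightarrow> x j) \<Longrightarrow> (\<lambda>m. f (X m) j) \<longlonglongrightarrow> f x j"
  shows "\<exists>x. (\<forall>j. x j \<in> {0..1}) \<and> (\<forall>j. f x j = x j)"
proof -
  define near where "near n x i y z \<longleftrightarrow> (\<forall>j. y j \<in> {0..1} \<and> z j \<in> {0..1} \<and>
    \<bar>y j - x j\<bar> \<le> 1 / real (Suc n) \<and> \<bar>z j - x j\<bar> \<le> 1 / real (Suc n)) \<and> y i \<le> f y i \<and> f z i \<le> z i"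
    for n i and x y z :: "nat \<Rightarrow> real"
  have "\<forall>n. \<exists>x. (\<forall>j. x j \<in> {0..1}) \<and> (\<forall>i<n. \<exists>y z. near n x i y z)"
    unfolding near_def by (intro allI near_fixed_point maps)
  then obtain X where X: "\<And>n j. X n j \<in> {0..1}" and "\<forall>n i. \<exists>y z. i < n \<longrightarrow> near n (X n) i y z"
    by metis
  then obtain Y Z where "\<And>n i. i < n \<Longrightarrow> near n (X n) i (Y n i) (Z n i)"
    by metis
  then have YZ: "\<And>n i j. i < n \<Longrightarrow> Y n i j \<in> {0..1}" "\<And>n i j. i < n \<Longrightarrow> Z n i j \<in> {0..1}"
      "\<And>n i j. i < n \<Longrightarrow> \<bar>Y n i j - X n j\<bar> \<le> 1 / real (Suc n)"
      "\<And>n i j. i < n \<Longrightarrow> \<bar>Z n i j - X n j\<bar> \<le> 1 / real (Suc n)"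
      "\<And>n i. i < n \<Longrightarrow> Y n i i \<le> f (Y n i) i" "\<And>n i. i < n \<Longrightarrow> f (Z n i) i \<le> Z n i i"
    unfolding near_def by blast+
  obtain x r where r: "strict_mono r" and x: "\<And>j. x j \<in> {0..1}" and lim: "\<And>j. (\<lambda>m. X (r m) j) \<longlonglongrightarrow> x j"
    using cube_convergent_subsequence[of X] X by blast
  have lim_near: "(\<lambda>m. W m j) \<longlonglongrightarrow> x j" if "\<And>m. \<bar>W m j - X (r m) j\<bar> \<le> 1 / real (Suc (r m))" for W j
  proof -
    have "(\<lambda>m. inverse (real (Suc (r m)))) \<longlonglongrightarrow> 0"
      using LIMSEQ_subseq_LIMSEQ[OF LIMSEQ_inverse_real_of_nat r] by (simp add: o_def)
    then have "(\<lambda>m. W m j - X (r m) j) \<longlonglongrightarrow> 0"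
      by (rule Lim_null_comparison[rotated]) (use that in \<open>simp add: inverse_eq_divide\<close>)
    from tendsto_add[OF this lim[of j]] show ?thesis by simp
  qed
  have ev: "\<forall>\<^sub>F m in sequentially. i < r m" for i
    using filterlim_subseq[OF r, unfolded filterlim_at_top, rule_format, of "Suc i"] by (simp only: Suc_le_eq)
  have "f x i = x i" for i
  proof (rule antisym)
    \<comment> \<open>\<open>Y\<close> is meaningful in direction \<open>i\<close> only from dimension \<open>i + 1\<close> on.\<close>
    define W where "W m = (if i < r m then Y (r m) i else X (r m))" for m
    have W: "W m j \<in> {0..1}" "\<bar>W m j - X (r m) j\<bar> \<le> 1 / real (Suc (r m))" for m j
      using X YZ by (auto simp: W_def simp del: of_nat_Suc)
    have "(\<lambda>m. f (W m) i) \<longlonglongrightarrow> f x i" by (intro cont W x lim_near)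
    then show "x i \<le> f x i"
      by (rule tendsto_le[OF _ _ lim_near[OF W(2)], rotated])
        (use ev[of i] YZ(5) in \<open>auto simp: W_def elim!: eventually_mono\<close>)
  next
    define W where "W m = (if i < r m then Z (r m) i else X (r m))" for m
    have W: "W m j \<in> {0..1}" "\<bar>W m j - X (r m) j\<bar> \<le> 1 / real (Suc (r m))" for m j
      using X YZ by (auto simp: W_def simp del: of_nat_Suc)
    have "(\<lambda>m. f (W m) i) \<longlonglongrightarrow> f x i" by (intro cont W x lim_near)
    then show "f x i \<le> x i"
      by (rule tendsto_le[OF _ lim_near[OF W(2)], rotated])
        (use ev[of i] YZ(6) in \<open>auto simp: W_def elim!: eventually_mono\<close>)
  qed
  with x show ?thesis by blast
qed

lemma countable_cube_fixed_point:
  fixes f :: "('j \<Rightarrow> real) \<Rightarrow> 'j \<Rightarrow> real"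
  assumes J: "countable J"
    and maps: "\<And>x j. (\<And>j. x j \<in> {0..1}) \<Longrightarrow> j \<in> J \<Longrightarrow> f x j \<in> {0..1}"
    and cont: "\<And>X x j. (\<And>m j. X m j \<in> {0..1}) \<Longrightarrow> (\<And>j. x j \<in> {0..1}) \<Longrightarrow>
      (\<And>j. (\<lambda>m. X m j) \<longlonglongrightarrow> x j) \<Longrightarrow> j \<in> J \<Longrightarrow> (\<lambda>m. f (X m) j) \<longlonglongrightarrow> f x j"
  shows "\<exists>x. (\<forall>j. x j \<in> {0..1}) \<and> (\<forall>j\<in>J. f x j = x j)"
proof -
  define dec where "dec y = (\<lambda>j. if j \<in> J then y (to_nat_on J j) else 0)" for y :: "nat \<Rightarrow> real"
  define g where "g y m = (if m \<in> to_nat_on J ` J then f (dec y) (from_nat_into J m) else 0)" for y m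
  have from_J: "from_nat_into J m \<in> J" if "m \<in> to_nat_on J ` J" for m
    using that J by auto
  have "\<exists>y. (\<forall>j. y j \<in> {0..1}) \<and> (\<forall>j. g y j = y j)"
  proof (rule hilbert_cube_fixed_point)
    show "g y j \<in> {0..1}" if "\<And>j. y j \<in> {0..1}" for y j
      using maps[of "dec y"] that from_J by (auto simp: g_def dec_def)
    fix X :: "nat \<Rightarrow> nat \<Rightarrow> real" and x j
    assume *: "\<And>m j. X m j \<in> {0..1}" "\<And>j. x j \<in> {0..1}" "\<And>j. (\<lambda>m. X m j) \<longlonglongrightarrow> x j"
    have "(\<lambda>m. f (dec (X m)) (from_nat_into J j)) \<longlonglongrightarrow> f (dec x) (from_nat_into J j)" if "j \<in> to_nat_on J ` J"
      using * by (intro cont from_J that) (auto simp: dec_def)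
    then show "(\<lambda>m. g (X m) j) \<longlonglongrightarrow> g x j"
      by (auto simp: g_def)
  qed
  then obtain y where y: "\<And>j. y j \<in> {0..1}" "\<And>j. g y j = y j" by blast
  have "f (dec y) j = dec y j" if "j \<in> J" for j
    using y(2)[of "to_nat_on J j"] that J by (simp add: g_def dec_def)
  then show ?thesis using y(1) by (intro exI[of _ "dec y"]) (auto simp: dec_def)
qed

section \<open>First-step decomposition of a Markov chain law\<close>

abbreviation path_space :: "(nat \<Rightarrow> 'x) measure" where
  "path_space \<equiv> PiM (UNIV :: nat set) (\<lambda>_. count_space UNIV)"

lemma sets_chain_law [measurable_cong]: "sets (chain_law \<mu> K) = sets path_space"
  by (simp add: chain_law_def)

lemma space_chain_law [simp]: "space (chain_law \<mu> K) = UNIV"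
  by (simp add: chain_law_def space_PiM)

text \<open>
  The integral of \<open>f \<omega>\<^sub>m\<close> over the event that \<open>\<omega>\<^sub>t \<in> B t\<close> for all \<open>t < m\<close>, for the chain with initial law
  \<open>\<mu>\<close> and transitions \<open>K\<close>.  The recursion peels off the last step, as the Ionescu-Tulcea construction
  does; the integrand \<open>f\<close> is a parameter so that the first step can be peeled off as well.
\<close>

primrec box_weight ::
    "'x pmf \<Rightarrow> (nat \<Rightarrow> 'x \<Rightarrow> 'x pmf) \<Rightarrow> (nat \<Rightarrow> 'x set) \<Rightarrow> nat \<Rightarrow> ('x \<Rightarrow> ennreal) \<Rightarrow> ennreal" where
  "box_weight \<mu> K B 0 f = (\<integral>\<^sup>+x. f x \<partial>measure_pmf \<mu>)"
| "box_weight \<mu> K B (Suc m) f =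
     box_weight \<mu> K B m (\<lambda>x. indicator (B m) x * (\<integral>\<^sup>+y. f y \<partial>measure_pmf (K m x)))"

lemma box_weight_first_step:
  "box_weight \<mu> K B (Suc m) f =
     (\<integral>\<^sup>+x. indicator (B 0) x * box_weight (K 0 x) (\<lambda>t. K (Suc t)) (\<lambda>t. B (Suc t)) m f \<partial>measure_pmf \<mu>)"
proof (induction m arbitrary: f)
  case (Suc m)
  then show ?case by (subst box_weight.simps(2)) simp
qed simp

lemma nn_integral_finite_path:
  "(\<integral>\<^sup>+\<omega>. indicator {\<omega>. \<forall>t<n. \<omega> t \<in> B t} \<omega> * (\<integral>\<^sup>+y. f y \<partial>chain_kernel \<mu> K n \<omega>)
      \<partial>chain.C \<mu> K 0 n (\<lambda>_. undefined)) = box_weight \<mu> K B n f"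
proof (induction n arbitrary: f)
  case 0
  show ?case
    by (simp add: nn_integral_return space_PiM emeasure_return) (simp add: chain_kernel_def)
next
  case (Suc n)
  let ?g = "\<lambda>x. \<integral>\<^sup>+y. f y \<partial>measure_pmf (K n x)"
  let ?h = "\<lambda>\<omega>. indicator {\<omega>. \<forall>t<Suc n. \<omega> t \<in> B t} \<omega> * ?g (\<omega> n)"
  have box: "PiE {0..<Suc n} B \<in> sets (PiM {0..<Suc n} (\<lambda>_. count_space UNIV))"
    by (rule sets_PiM_I_finite) simp_all
  have "indicator {\<omega>. \<forall>t<Suc n. \<omega> t \<in> B t} \<omega> = (indicator (PiE {0..<Suc n} B) \<omega> :: ennreal)"
    if "\<omega> \<in> space (PiM {0..<Suc n} (\<lambda>_. count_space UNIV))" for \<omega>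
    using that by (simp add: indicator_def space_PiM PiE_iff Ball_def)
  then have ind: "(\<lambda>\<omega>. indicator {\<omega>. \<forall>t<Suc n. \<omega> t \<in> B t} \<omega> :: ennreal)
      \<in> borel_measurable (PiM {0..<Suc n} (\<lambda>_. count_space UNIV))"
    using borel_measurable_indicator[OF box] by (rule measurable_cong[THEN iffD2])
  have g: "(\<lambda>\<omega>. ?g (\<omega> n)) \<in> borel_measurable (PiM {0..<Suc n} (\<lambda>_. count_space UNIV))"
  proof (rule measurable_compose[of "\<lambda>\<omega>. \<omega> n" _ "count_space UNIV"])
    show "(\<lambda>\<omega>. \<omega> n) \<in> PiM {0..<Suc n} (\<lambda>_. count_space UNIV) \<rightarrow>\<^sub>M count_space UNIV"
      by (rule measurable_component_singleton) simp
  qed simp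
  have h: "?h \<in> borel_measurable (PiM {0..<Suc n} (\<lambda>_. count_space UNIV))"
    by (rule borel_measurable_times_ennreal[OF ind g])
  have "(\<integral>\<^sup>+\<omega>. ?h \<omega> \<partial>chain.C \<mu> K 0 (Suc n) (\<lambda>_. undefined)) =
        (\<integral>\<^sup>+\<omega>. (\<integral>\<^sup>+\<omega>'. ?h \<omega>' \<partial>chain.eP \<mu> K n \<omega>) \<partial>chain.C \<mu> K 0 n (\<lambda>_. undefined))"
  proof -
    have "sets (chain.C \<mu> K 0 n (\<lambda>_. undefined)) = sets (PiM {0..<n} (\<lambda>_. count_space UNIV))"
      using chain.sets_C[of "\<lambda>_. undefined" 0 \<mu> K n] by (simp add: space_PiM)
    then have "chain.eP \<mu> K n \<in> chain.C \<mu> K 0 n (\<lambda>_. undefined)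
        \<rightarrow>\<^sub>M subprob_algebra (PiM {0..<Suc n} (\<lambda>_. count_space UNIV))"
      using chain.measurable_eP[of \<mu> K n] by (subst measurable_cong_sets[OF _ refl])
    from nn_integral_bind[OF h this] show ?thesis by (simp only: chain.C.simps add_0)
  qed
  also have "\<dots> = (\<integral>\<^sup>+\<omega>. indicator {\<omega>. \<forall>t<n. \<omega> t \<in> B t} \<omega> *
       (\<integral>\<^sup>+y. indicator (B n) y * ?g y \<partial>chain_kernel \<mu> K n \<omega>) \<partial>chain.C \<mu> K 0 n (\<lambda>_. undefined))"
  proof (rule nn_integral_cong)
    fix \<omega> assume "\<omega> \<in> space (chain.C \<mu> K 0 n (\<lambda>_. undefined))"
    then have \<omega>: "\<omega> \<in> space (PiM {0..<n} (\<lambda>_. count_space UNIV))"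
      by (simp add: chain.space_C space_PiM)
    have "(\<integral>\<^sup>+\<omega>'. ?h \<omega>' \<partial>chain.eP \<mu> K n \<omega>) = (\<integral>\<^sup>+y. ?h (fun_upd \<omega> n y) \<partial>chain_kernel \<mu> K n \<omega>)"
      by (rule chain.nn_integral_eP[OF \<omega> h])
    also have "\<dots> = (\<integral>\<^sup>+y. indicator {\<omega>. \<forall>t<n. \<omega> t \<in> B t} \<omega> * (indicator (B n) y * ?g y) \<partial>chain_kernel \<mu> K n \<omega>)"
      by (intro nn_integral_cong) (auto simp: indicator_def less_Suc_eq)
    also have "\<dots> = indicator {\<omega>. \<forall>t<n. \<omega> t \<in> B t} \<omega> * (\<integral>\<^sup>+y. (indicator (B n) y * ?g y) \<partial>chain_kernel \<mu> K n \<omega>)"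
      by (rule nn_integral_cmult) (simp add: chain_kernel_def)
    finally show "(\<integral>\<^sup>+\<omega>'. ?h \<omega>' \<partial>chain.eP \<mu> K n \<omega>) = \<dots>" .
  qed
  also have "\<dots> = box_weight \<mu> K B (Suc n) f"
    by (simp add: Suc.IH)
  finally have "(\<integral>\<^sup>+\<omega>. ?h \<omega> \<partial>chain.C \<mu> K 0 (Suc n) (\<lambda>_. undefined)) = box_weight \<mu> K B (Suc n) f" .
  moreover have "chain_kernel \<mu> K (Suc n) \<omega> = measure_pmf (K n (\<omega> n))" for \<omega>
    by (simp add: chain_kernel_def)
  ultimately show ?case by (simp only:)
qed

lemma emeasure_chain_law_box:
  "emeasure (chain_law \<mu> K) {\<omega>. \<forall>t<n. \<omega> t \<in> B t} = box_weight \<mu> K B n (\<lambda>_. 1)"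
proof -
  let ?M = "PiM {0..<n} (\<lambda>_. count_space UNIV)"
  have B: "PiE {0..<n} B \<in> sets ?M" by (auto intro!: sets_PiM_I_finite)
  have C: "sets (chain.C \<mu> K 0 n (\<lambda>_. undefined)) = sets ?M" "space (chain.C \<mu> K 0 n (\<lambda>_. undefined)) = space ?M"
    using chain.sets_C[of "\<lambda>_. undefined" 0 \<mu> K n] chain.space_C[of "\<lambda>_. undefined" 0 \<mu> K n] by (auto simp: space_PiM)
  have "{\<omega>. \<forall>t<n. \<omega> t \<in> B t} = prod_emb UNIV (\<lambda>_. count_space UNIV) {0..<n} (PiE {0..<n} B)"
    by (auto simp: prod_emb_def PiE_iff)
  then have "emeasure (chain_law \<mu> K) {\<omega>. \<forall>t<n. \<omega> t \<in> B t} = emeasure (chain.CI \<mu> K {0..<n}) (PiE {0..<n} B)"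
    using chain.lim[OF _ B, of \<mu> K] by (simp add: chain_law_def)
  also have "\<dots> = emeasure (chain.C \<mu> K 0 n (\<lambda>_. undefined)) (PiE {0..<n} B)"
    using B by (subst chain.emeasure_CI[OF order_refl]) (auto simp: prod_emb_id)
  also have "\<dots> = (\<integral>\<^sup>+\<omega>. indicator {\<omega>. \<forall>t<n. \<omega> t \<in> B t} \<omega> * (\<integral>\<^sup>+y. 1 \<partial>chain_kernel \<mu> K n \<omega>)
      \<partial>chain.C \<mu> K 0 n (\<lambda>_. undefined))"
    using B by (subst nn_integral_indicator[symmetric], simp add: C)
      (intro nn_integral_cong, auto simp: C space_PiM indicator_def chain_kernel_def PiE_iff)
  also have "\<dots> = box_weight \<mu> K B n (\<lambda>_. 1)"
    by (rule nn_integral_finite_path)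
  finally show ?thesis .
qed

lemma measurable_case_nat_path: "case_nat x \<in> path_space \<rightarrow>\<^sub>M path_space"
proof (rule measurable_PiM_single')
  show "(\<lambda>\<omega>. case_nat x \<omega> i) \<in> path_space \<rightarrow>\<^sub>M count_space UNIV" for i
    by (cases i) auto
qed (auto simp: space_PiM)

text \<open>
  Both sides are finite measures in \<open>A\<close> on the path space, so it suffices to compare them on boxes, where
  the identity is \<open>box_weight_first_step\<close>.
\<close>

lemma chain_law_first_step:
  assumes A: "A \<in> sets path_space"
  shows "emeasure (chain_law \<mu> K) A =
    (\<integral>\<^sup>+x. emeasure (chain_law (K 0 x) (\<lambda>t. K (Suc t))) {\<omega>. case_nat x \<omega> \<in> A} \<partial>measure_pmf \<mu>)"
proof -
  define \<kappa> where "\<kappa> x = distr (chain_law (K 0 x) (\<lambda>t. K (Suc t))) path_space (case_nat x)" for x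
  have em: "emeasure (\<kappa> x) A = emeasure (chain_law (K 0 x) (\<lambda>t. K (Suc t))) {\<omega>. case_nat x \<omega> \<in> A}"
    if "A \<in> sets path_space" for x A
    unfolding \<kappa>_def using that measurable_case_nat_path[of x]
    by (subst emeasure_distr) (auto simp: vimage_def cong: measurable_cong_sets)
  have "prob_space (\<kappa> x)" for x
    unfolding \<kappa>_def using measurable_case_nat_path[of x]
    by (intro prob_space.prob_space_distr prob_space_chain_law) (auto cong: measurable_cong_sets)
  then have \<kappa>: "\<kappa> \<in> measure_pmf \<mu> \<rightarrow>\<^sub>M subprob_algebra path_space"
    by (auto simp: space_subprob_algebra prob_space_imp_subprob_space) (auto simp: \<kappa>_def)
  have em_bind: "emeasure (measure_pmf \<mu> \<bind> \<kappa>) A =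
      (\<integral>\<^sup>+x. emeasure (chain_law (K 0 x) (\<lambda>t. K (Suc t))) {\<omega>. case_nat x \<omega> \<in> A} \<partial>measure_pmf \<mu>)"
    if "A \<in> sets path_space" for A
    using that by (subst emeasure_bind[OF _ \<kappa>]) (auto simp: em)
  have "chain_law \<mu> K = measure_pmf \<mu> \<bind> \<kappa>"
  proof (rule measure_eqI_PiM_infinite)
    show "sets (chain_law \<mu> K) = sets path_space" by (rule sets_chain_law)
    show "sets (measure_pmf \<mu> \<bind> \<kappa>) = sets path_space"
      by (rule sets_bind) (auto simp: \<kappa>_def)
    show "finite_measure (chain_law \<mu> K)"
      by (simp add: prob_space_chain_law prob_space.finite_measure)
    fix A :: "nat \<Rightarrow> 'a set" and J :: "nat set" assume J: "finite J"
    let ?E = "prod_emb UNIV (\<lambda>_. count_space UNIV) J (PiE J A)"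
    define B where "B t = (if t \<in> J then A t else UNIV)" for t
    obtain n where n: "J \<subseteq> {..<n}" using finite_nat_bounded[OF J] by blast
    have "i < Suc n" if "i \<in> J" for i using n that by (auto intro: less_SucI)
    then have *: "(\<forall>i\<in>J. \<omega> i \<in> A i) \<longleftrightarrow> (\<forall>t<Suc n. \<omega> t \<in> B t)" for \<omega>
      by (force simp: B_def split: if_splits)
    have "?E = {\<omega>. \<forall>i\<in>J. \<omega> i \<in> A i}"
      by (rule set_eqI) (simp only: prod_emb_iff PiE_iff restrict_apply extensional_UNIV space_count_space
        UNIV_I mem_Collect_eq simp_thms ball_simps restrict_extensional if_True ball_UNIV cong: ball_cong)
    then have E: "?E = {\<omega>. \<forall>t<Suc n. \<omega> t \<in> B t}"
      by (simp only: *)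
    have "?E \<in> sets path_space" using J by (rule sets_PiM_I) auto
    then have "emeasure (measure_pmf \<mu> \<bind> \<kappa>) ?E =
        (\<integral>\<^sup>+x. emeasure (chain_law (K 0 x) (\<lambda>t. K (Suc t))) {\<omega>. case_nat x \<omega> \<in> ?E} \<partial>measure_pmf \<mu>)"
      by (rule em_bind)
    also have "\<dots> = (\<integral>\<^sup>+x. indicator (B 0) x *
        emeasure (chain_law (K 0 x) (\<lambda>t. K (Suc t))) {\<omega>. \<forall>t<n. \<omega> t \<in> B (Suc t)} \<partial>measure_pmf \<mu>)"
      unfolding E by (intro nn_integral_cong) (auto simp: indicator_def All_less_Suc2)
    also have "\<dots> = emeasure (chain_law \<mu> K) ?E"
      unfolding E emeasure_chain_law_box box_weight_first_step ..
    finally show "emeasure (chain_law \<mu> K) ?E = emeasure (measure_pmf \<mu> \<bind> \<kappa>) ?E" ..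
  qed
  with em_bind[OF A] show ?thesis by simp
qed

text \<open>
  A mixture of initial laws gives the mixture of the path laws, because the first-step decomposition is
  linear in the initial law.
\<close>

lemma chain_law_bind_pmf:
  assumes A: "A \<in> sets path_space"
  shows "emeasure (chain_law (bind_pmf p \<mu>) K) A = (\<integral>\<^sup>+y. emeasure (chain_law (\<mu> y) K) A \<partial>measure_pmf p)"
  by (simp add: chain_law_first_step[OF A] nn_integral_bind_pmf)

section \<open>Winning and survival probabilities\<close>

lemma sets_law [measurable_cong]: "sets (law G \<pi> n h) = sets path_space"
  by (simp add: law_def sets_chain_law)

lemma space_law [simp]: "space (law G \<pi> n h) = UNIV"
  by (simp add: law_def)

lemma prob_space_law: "prob_space (law G \<pi> n h)"
  by (simp add: law_def prob_space_chain_law)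

lemma sets_case_nat_path: "A \<in> sets path_space \<Longrightarrow> {\<omega>. case_nat x \<omega> \<in> A} \<in> sets path_space"
  using measurable_sets[OF measurable_case_nat_path, of A x] by (simp add: vimage_def space_PiM)

abbreviation joint :: "('k::finite \<Rightarrow> ('s, 'a, 'k) policy) \<Rightarrow> nat \<Rightarrow> ('s, 'a, 'k) hist \<Rightarrow> ('k \<Rightarrow> 'a) pmf" where
  "joint \<pi> n h \<equiv> Pi_pmf UNIV undefined (\<lambda>k. \<pi> k n h)"

text \<open>
  The states of the chain are pairs of a history and the action chosen there, so its first transition
  contains the decision at time \<open>n + 1\<close> already.  Drawing the next state alone leaves that decision as
  the initial law of the restarted process (\<open>chain_law_bind_pmf\<close>).
\<close>

lemma emeasure_law_first_step:
  assumes A: "A \<in> sets path_space"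
  shows "emeasure (law G \<pi> n h) A =
    (\<integral>\<^sup>+a. (\<integral>\<^sup>+j. emeasure (law G \<pi> (Suc n) (extend_hist G n h a j)) {\<omega>. case_nat (h, a) \<omega> \<in> A}
        \<partial>measure_pmf (transit G n (cur_state h) a)) \<partial>measure_pmf (joint \<pi> n h))"
  unfolding law_def
  by (subst chain_law_first_step[OF A])
    (simp add: decide_def[of \<pi> n] chain_law_bind_pmf[OF sets_case_nat_path[OF A]])

lemma prob_law_first_step:
  fixes G :: "('s, 'a, 'k::finite) game"
  assumes A: "A \<in> sets path_space"
  shows "measure (law G \<pi> n h) A =
    (\<integral>a. (\<integral>j. measure (law G \<pi> (Suc n) (extend_hist G n h a j)) {\<omega>. case_nat (h, a) \<omega> \<in> A}
        \<partial>measure_pmf (transit G n (cur_state h) a)) \<partial>measure_pmf (joint \<pi> n h))"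
proof -
  interpret L: prob_space "law G \<pi> m h'" for m h' by (rule prob_space_law)
  have int: "integrable (measure_pmf p) f" if "\<And>x. 0 \<le> f x \<and> f x \<le> 1" for p and f :: "'x \<Rightarrow> real"
    by (rule measure_pmf.integrable_const_bound[of _ 1]) (use that in auto)
  have bnd: "0 \<le> measure_pmf.expectation p f \<and> measure_pmf.expectation p f \<le> 1"
    if "\<And>x. 0 \<le> f x \<and> f x \<le> 1" for p and f :: "'x \<Rightarrow> real"
    using int[of f p] that by (auto intro!: integral_nonneg_AE measure_pmf.integral_le_const)
  have "ennreal (measure (law G \<pi> n h) A) = (\<integral>\<^sup>+a. (\<integral>\<^sup>+j. ennreal (measure (law G \<pi> (Suc n) (extend_hist G n h a j)) {\<omega>. case_nat (h, a) \<omega> \<in> A})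
        \<partial>measure_pmf (transit G n (cur_state h) a)) \<partial>measure_pmf (joint \<pi> n h))"
    by (simp only: emeasure_law_first_step[OF A, of G \<pi> n h] L.emeasure_eq_measure[symmetric])
  also have "\<dots> = (\<integral>\<^sup>+a. ennreal (\<integral>j. measure (law G \<pi> (Suc n) (extend_hist G n h a j)) {\<omega>. case_nat (h, a) \<omega> \<in> A}
        \<partial>measure_pmf (transit G n (cur_state h) a)) \<partial>measure_pmf (joint \<pi> n h))"
    by (intro nn_integral_cong nn_integral_eq_integral int) auto
  also have "\<dots> = ennreal (\<integral>a. (\<integral>j. measure (law G \<pi> (Suc n) (extend_hist G n h a j)) {\<omega>. case_nat (h, a) \<omega> \<in> A}
        \<partial>measure_pmf (transit G n (cur_state h) a)) \<partial>measure_pmf (joint \<pi> n h))"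
    by (intro nn_integral_eq_integral int bnd) (auto intro: bnd)
  finally show ?thesis
    by (rule ennreal_inj[THEN iffD1, rotated 2]) (auto intro!: integral_nonneg_AE AE_pmfI)
qed

abbreviation state_of :: "(nat \<Rightarrow> ('s, 'a, 'k) hist \<times> ('k \<Rightarrow> 'a)) \<Rightarrow> nat \<Rightarrow> 's" where
  "state_of \<omega> m \<equiv> cur_state (fst (\<omega> m))"

lemma less_hit_time_iff:
  "enat (n + m) < hit_time G n \<omega> \<longleftrightarrow> (\<forall>s\<le>m. state_of \<omega> s \<notin> target G)"
proof -
  have "enat (n + m) < hit_time G n \<omega> \<longleftrightarrow> (\<forall>t. n \<le> t \<and> state_at n \<omega> t \<in> target G \<longrightarrow> n + m < t)"
  proof
    assume "enat (n + m) < hit_time G n \<omega>"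
    show "\<forall>t. n \<le> t \<and> state_at n \<omega> t \<in> target G \<longrightarrow> n + m < t"
    proof (intro allI impI)
      fix t assume "n \<le> t \<and> state_at n \<omega> t \<in> target G"
      then have "hit_time G n \<omega> \<le> enat t" unfolding hit_time_def by (intro Inf_lower) auto
      with \<open>enat (n + m) < hit_time G n \<omega>\<close> have "enat (n + m) < enat t" by (rule less_le_trans)
      then show "n + m < t" by simp
    qed
  next
    assume *: "\<forall>t. n \<le> t \<and> state_at n \<omega> t \<in> target G \<longrightarrow> n + m < t"
    have "enat (n + m) < enat (Suc (n + m))" by simp
    also have "\<dots> \<le> hit_time G n \<omega>"
      unfolding hit_time_def by (rule Inf_greatest) (use * in auto)
    finally show "enat (n + m) < hit_time G n \<omega>" .
  qed
  also have "\<dots> \<longleftrightarrow> (\<forall>s\<le>m. state_of \<omega> s \<notin> target G)"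
    unfolding state_at_def
  proof safe
    fix s assume *: "\<forall>t. n \<le> t \<and> state_of \<omega> (t - n) \<in> target G \<longrightarrow> n + m < t" "s \<le> m" "state_of \<omega> s \<in> target G"
    show False using *(1)[rule_format, of "n + s"] *(2,3) by simp
  next
    fix t assume "\<forall>s\<le>m. state_of \<omega> s \<notin> target G" "n \<le> t" "state_of \<omega> (t - n) \<in> target G"
    then have "\<not> t - n \<le> m" by blast
    then show "n + m < t" by simp
  qed
  finally show ?thesis .
qed

lemma hit_time_finite_iff: "hit_time G n \<omega> < \<infinity> \<longleftrightarrow> (\<exists>m. state_of \<omega> m \<in> target G)"
proof -
  have "hit_time G n \<omega> < \<infinity> \<longleftrightarrow> (\<exists>t. n \<le> t \<and> state_at n \<omega> t \<in> target G)"
    unfolding hit_time_def Inf_less_iff by auto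
  also have "\<dots> \<longleftrightarrow> (\<exists>m. state_of \<omega> m \<in> target G)"
    unfolding state_at_def by (metis add_diff_cancel_left' le_add1)
  finally show ?thesis .
qed

lemma suminf_ennreal_first: "(\<Sum>m. f m) = f 0 + (\<Sum>m. f (Suc m))" for f :: "nat \<Rightarrow> ennreal"
  using sums_Suc[of f, OF summable_sums[OF summableI]] by (simp add: sums_iff add.commute)

lemma suminf_ennreal_zero_prefix:
  "(\<And>t. t < n \<Longrightarrow> f t = 0) \<Longrightarrow> (\<Sum>t. f t) = (\<Sum>m. f (n + m))" for f :: "nat \<Rightarrow> ennreal"
proof (induction n arbitrary: f)
  case (Suc n)
  then show ?case
    using Suc.IH[of "\<lambda>m. f (Suc m)"] suminf_ennreal_first[of f] by simp
qed simp

text \<open>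
  In relative time the gain collects a reward at every step up to and including which the target has
  been avoided; in this form its first term can be split off.
\<close>

lemma gain_eq:
  "gain G n k \<omega> = (\<Sum>m. if \<forall>s\<le>m. state_of \<omega> s \<notin> target G
     then ennreal (of_rat (reward G (n + m) k (state_of \<omega> m) (snd (\<omega> m)))) else 0)"
  unfolding gain_def
  by (subst suminf_ennreal_zero_prefix[of n]) (auto simp: less_hit_time_iff state_at_def act_at_def cong: if_cong)

lemma gain_case_nat:
  "gain G n k (case_nat (h, a) \<omega>) =
     (if cur_state h \<in> target G then 0
      else ennreal (of_rat (reward G n k (cur_state h) a)) + gain G (Suc n) k \<omega>)"
  unfolding gain_eq
  by (subst suminf_ennreal_first) (auto simp: less_Suc_eq_le[symmetric] All_less_Suc2 cong: if_cong)

lemma measurable_gain: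
  fixes G :: "('s, 'a, 'k) game"
  shows "gain G n k \<in> borel_measurable path_space"
proof -
  have c: "(\<lambda>\<omega>. f (\<omega> m)) \<in> path_space \<rightarrow>\<^sub>M M" if "f \<in> count_space UNIV \<rightarrow>\<^sub>M M" for f :: "('s, 'a, 'k) hist \<times> ('k \<Rightarrow> 'a) \<Rightarrow> 'x" and m M
    using measurable_component_singleton[of m UNIV "\<lambda>_. count_space UNIV"] that
    by (rule measurable_compose[of "\<lambda>\<omega>. \<omega> m"]) simp
  have "Measurable.pred path_space (\<lambda>\<omega> :: nat \<Rightarrow> ('s, 'a, 'k) hist \<times> ('k \<Rightarrow> 'a). state_of \<omega> s \<notin> target G)" for s
    using c[of "\<lambda>x. cur_state (fst x) \<notin> target G" "count_space UNIV" s] by simp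
  moreover have "(\<lambda>\<omega>. ennreal (of_rat (reward G (n + m) k (state_of \<omega> m) (snd (\<omega> m))))) \<in> borel_measurable path_space" for m
    by (rule c[of "\<lambda>x. ennreal (of_rat (reward G (n + m) k (cur_state (fst x)) (snd x)))"]) simp
  ultimately show ?thesis unfolding gain_eq[abs_def] by measurable
qed

definition goal_event :: "('s, 'a, 'k) game \<Rightarrow> nat \<Rightarrow> 'k \<Rightarrow> rat \<Rightarrow> (nat \<Rightarrow> ('s, 'a, 'k) hist \<times> ('k \<Rightarrow> 'a)) set" where
  "goal_event G n k c = {\<omega>. ereal (of_rat c) \<le> enn2ereal (gain G n k \<omega>)}"

lemma sets_goal_event: "goal_event G n k c \<in> sets path_space"
proof -
  note measurable_gain[measurable]
  have "{\<omega> \<in> space path_space. ereal (of_rat c) \<le> enn2ereal (gain G n k \<omega>)} \<in> sets path_space"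
    by measurable
  then show ?thesis by (simp add: goal_event_def space_PiM)
qed

text \<open>
  Earning \<open>c\<close> in total is the same as earning, after the first reward, what then remains of the goal.
  This is why the remaining goals, which are part of the history, carry all that matters of the past.
\<close>

lemma goal_event_case_nat:
  assumes "cur_state h \<notin> target G" "0 \<le> reward G n k (cur_state h) a"
  shows "case_nat (h, a) \<omega> \<in> goal_event G n k c \<longleftrightarrow>
    \<omega> \<in> goal_event G (Suc n) k (c - reward G n k (cur_state h) a)"
proof -
  let ?r = "of_rat (reward G n k (cur_state h) a) :: real"
  have "enn2ereal (ennreal ?r + gain G (Suc n) k \<omega>) = ereal ?r + enn2ereal (gain G (Suc n) k \<omega>)"
    using assms by (simp add: plus_ennreal.rep_eq enn2ereal_ennreal)
  with assms show ?thesis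
    by (cases "enn2ereal (gain G (Suc n) k \<omega>)") (auto simp: goal_event_def gain_case_nat of_rat_diff)
qed

lemma goal_event_case_nat_target:
  "cur_state h \<in> target G \<Longrightarrow> case_nat (h, a) \<omega> \<in> goal_event G n k c \<longleftrightarrow> c \<le> 0"
  by (simp add: goal_event_def gain_case_nat zero_ennreal.rep_eq)

text \<open>
  The performance function \<open>F\<close> for a process that is started from an arbitrary history: one step after
  the start the past is no longer empty.
\<close>

definition win_prob :: "('s, 'a, 'k::finite) game \<Rightarrow> ('k \<Rightarrow> ('s, 'a, 'k) policy) \<Rightarrow> 'k \<Rightarrow> nat \<Rightarrow> ('s, 'a, 'k) hist \<Rightarrow> real" where
  "win_prob G \<pi> k n h = measure (law G \<pi> n h) (goal_event G n k (cur_goal h k))"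

lemma F_eq_win_prob: "F G n k i g \<pi> = win_prob G \<pi> k n ([], i, g)"
  by (simp add: F_def win_prob_def goal_event_def cur_goal_def)

lemma cur_extend [simp]:
  "cur_state (extend_hist G n h a j) = j"
  "cur_goal (extend_hist G n h a j) = (\<lambda>l. cur_goal h l - reward G n l (cur_state h) a)"
  by (cases h; simp add: cur_state_def cur_goal_def)+

lemma win_prob_target: "cur_state h \<in> target G \<Longrightarrow> win_prob G \<pi> k n h = of_bool (cur_goal h k \<le> 0)"
  using prob_space.prob_space[OF prob_space_law, of G \<pi>]
  by (simp add: win_prob_def prob_law_first_step[OF sets_goal_event] goal_event_case_nat_target)

lemma win_prob_first_step:
  assumes "cur_state h \<notin> target G" and "\<And>a. a \<in> set_pmf (joint \<pi> n h) \<Longrightarrow> 0 \<le> reward G n k (cur_state h) a"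
  shows "win_prob G \<pi> k n h = (\<integral>a. (\<integral>j. win_prob G \<pi> k (Suc n) (extend_hist G n h a j)
        \<partial>measure_pmf (transit G n (cur_state h) a)) \<partial>measure_pmf (joint \<pi> n h))"
  unfolding win_prob_def prob_law_first_step[OF sets_goal_event[of G n k]]
  by (intro integral_cong_AE AE_pmfI) (use assms in \<open>auto simp: goal_event_case_nat\<close>)

text \<open>
  The event concerns the first \<open>m\<close> steps only, so it is certain for \<open>m = 0\<close>, even if the start lies in the
  target.
\<close>

definition survival :: "('s, 'a, 'k::finite) game \<Rightarrow> ('k \<Rightarrow> ('s, 'a, 'k) policy) \<Rightarrow> nat \<Rightarrow> nat \<Rightarrow> ('s, 'a, 'k) hist \<Rightarrow> real" where
  "survival G \<pi> m n h = measure (law G \<pi> n h) {\<omega>. \<forall>s<m. state_of \<omega> s \<notin> target G}"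

lemma sets_survival: "{\<omega>. \<forall>s<m. state_of \<omega> s \<notin> target G} \<in> sets path_space"
proof -
  have "{\<omega> \<in> space path_space. state_of \<omega> s \<notin> target G} \<in> sets path_space" for s
    by (rule sets_Collect_single'[of s UNIV "\<lambda>_. count_space UNIV"]) auto
  then have "{\<omega> \<in> space path_space. \<forall>s<m. state_of \<omega> s \<notin> target G} \<in> sets path_space"
    by (intro sets.sets_Collect_countable_All sets.sets_Collect_imp sets.sets_Collect_const)
  then show ?thesis by (simp add: space_PiM)
qed

lemma survival_0: "survival G \<pi> 0 n h = 1"
  using prob_space.prob_space[OF prob_space_law, of G \<pi> n h] by (simp add: survival_def)

lemma survival_Suc:
  "survival G \<pi> (Suc m) n h = (if cur_state h \<in> target G then 0 else
    (\<integral>a. (\<integral>j. survival G \<pi> m (Suc n) (extend_hist G n h a j)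
        \<partial>measure_pmf (transit G n (cur_state h) a)) \<partial>measure_pmf (joint \<pi> n h)))"
  unfolding survival_def
  by (subst prob_law_first_step[OF sets_survival]) (simp add: All_less_Suc2)

text \<open>
  The events decrease to the event that the target is never hit, which is null by Assumption A.
\<close>

lemma survival_tendsto_0:
  assumes "assumption_A G" "\<pi> \<in> multipolicies G" "h \<in> hists G n" "cur_state h \<notin> target G"
  shows "(\<lambda>m. survival G \<pi> m n h) \<longlonglongrightarrow> 0"
proof -
  interpret prob_space "law G \<pi> n h" by (rule prob_space_law)
  let ?A = "\<lambda>m. {\<omega>. \<forall>s<m. state_of \<omega> s \<notin> target G}"
  have A: "?A m \<in> sets (law G \<pi> n h)" for m
    using sets_survival by (simp add: sets_law)
  have "(\<lambda>m. prob (?A m)) \<longlonglongrightarrow> prob (\<Inter>m. ?A m)"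
    by (rule finite_Lim_measure_decseq) (use A in \<open>auto simp: decseq_def\<close>)
  moreover have "(\<Inter>m. ?A m) = space (law G \<pi> n h) - {\<omega>. hit_time G n \<omega> < \<infinity>}"
    unfolding hit_time_finite_iff by auto
  moreover have "{\<omega>. hit_time G n \<omega> < \<infinity>} = space (law G \<pi> n h) - (\<Inter>m. ?A m)"
    unfolding hit_time_finite_iff by auto
  then have "{\<omega>. hit_time G n \<omega> < \<infinity>} \<in> events"
    using A by (simp only:) (intro sets.Diff sets.top sets.countable_INT, auto)
  moreover have "prob {\<omega>. hit_time G n \<omega> < \<infinity>} = 1"
    using assms by (auto simp: assumption_A_def)
  ultimately show ?thesis
    unfolding survival_def by (simp only: prob_compl) simp
qed

section \<open>Comparison with solutions of the optimality inequalities\<close>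

lemma integrable_pmf_bounded:
  fixes f :: "'x \<Rightarrow> real"
  assumes "\<And>x. x \<in> set_pmf p \<Longrightarrow> \<bar>f x\<bar> \<le> c"
  shows "integrable (measure_pmf p) f"
  by (rule measure_pmf.integrable_const_bound[of _ c]) (use assms in \<open>auto intro: AE_pmfI\<close>)

lemma abs_expectation_le:
  fixes f :: "'x \<Rightarrow> real"
  assumes "\<And>x. x \<in> set_pmf p \<Longrightarrow> \<bar>f x\<bar> \<le> c"
  shows "\<bar>measure_pmf.expectation p f\<bar> \<le> c"
proof -
  have "\<bar>measure_pmf.expectation p f\<bar> \<le> measure_pmf.expectation p (\<lambda>x. \<bar>f x\<bar>)"
    by (rule integral_abs_bound)
  also have "\<dots> \<le> c"
    by (rule measure_pmf.integral_le_const) (use assms in \<open>auto intro!: AE_pmfI integrable_pmf_bounded[of _ _ c]\<close>)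
  finally show ?thesis .
qed

lemma expectation_le_add:
  fixes f g s :: "'x \<Rightarrow> real"
  assumes "\<And>x. x \<in> set_pmf p \<Longrightarrow> f x \<le> g x + s x"
    and "\<And>x. x \<in> set_pmf p \<Longrightarrow> \<bar>f x\<bar> \<le> c \<and> \<bar>g x\<bar> \<le> c \<and> \<bar>s x\<bar> \<le> c"
  shows "measure_pmf.expectation p f \<le> measure_pmf.expectation p g + measure_pmf.expectation p s"
proof -
  have int: "integrable (measure_pmf p) f" "integrable (measure_pmf p) g" "integrable (measure_pmf p) s"
    using assms(2) by (auto intro!: integrable_pmf_bounded[of _ _ c])
  have "measure_pmf.expectation p f \<le> measure_pmf.expectation p (\<lambda>x. g x + s x)"
    by (rule integral_mono_AE) (use int assms(1) in \<open>auto intro: AE_pmfI\<close>)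
  then show ?thesis using int by simp
qed

definition next_expectation ::
    "('s, 'a, 'k::finite) game \<Rightarrow> ('k \<Rightarrow> ('s, 'a, 'k) policy) \<Rightarrow> nat \<Rightarrow> ('s, 'a, 'k) hist
      \<Rightarrow> (('s, 'a, 'k) hist \<Rightarrow> real) \<Rightarrow> real" where
  "next_expectation G \<pi> n h f =
    (\<integral>a. (\<integral>j. f (extend_hist G n h a j) \<partial>measure_pmf (transit G n (cur_state h) a)) \<partial>measure_pmf (joint \<pi> n h))"

lemma next_expectation_le_add:
  assumes "\<And>a j. a \<in> set_pmf (joint \<pi> n h) \<Longrightarrow> j \<in> set_pmf (transit G n (cur_state h) a) \<Longrightarrow>
    f (extend_hist G n h a j) \<le> g (extend_hist G n h a j) + s (extend_hist G n h a j) \<and>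
    \<bar>f (extend_hist G n h a j)\<bar> \<le> 1 \<and> \<bar>g (extend_hist G n h a j)\<bar> \<le> 1 \<and> \<bar>s (extend_hist G n h a j)\<bar> \<le> 1"
  shows "next_expectation G \<pi> n h f \<le> next_expectation G \<pi> n h g + next_expectation G \<pi> n h s"
  unfolding next_expectation_def
proof (rule expectation_le_add[where c=1])
  fix a assume a: "a \<in> set_pmf (joint \<pi> n h)"
  let ?E = "\<lambda>f. \<integral>j. f (extend_hist G n h a j) \<partial>measure_pmf (transit G n (cur_state h) a)"
  show "?E f \<le> ?E g + ?E s"
    by (rule expectation_le_add[where c=1]) (use assms[OF a] in auto)
  show "\<bar>?E f\<bar> \<le> 1 \<and> \<bar>?E g\<bar> \<le> 1 \<and> \<bar>?E s\<bar> \<le> 1"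
    by (intro conjI abs_expectation_le) (use assms[OF a] in auto)
qed

text \<open>
  The value of the game as a function on all states: in the target nothing more is earned, so that a goal
  is met there exactly if it is not positive.
\<close>

definition with_target :: "('s, 'a, 'k) game \<Rightarrow> 'k \<Rightarrow> ('s \<Rightarrow> ('k \<Rightarrow> rat) \<Rightarrow> real) \<Rightarrow> 's \<Rightarrow> ('k \<Rightarrow> rat) \<Rightarrow> real" where
  "with_target G k u i g = (if i \<in> target G then of_bool (g k \<le> 0) else u i g)"

text \<open>
  The set \<open>\<U>\<close> without its boundary condition.  A fixed point in a cube yields only this much; that the
  value is \<open>1\<close> for negative goals is inferred once the fixed point is known to be a winning probability.
\<close>

definition unit_valued :: "('s, 'a, 'k) game \<Rightarrow> nat \<Rightarrow> ('s \<Rightarrow> ('k \<Rightarrow> rat) \<Rightarrow> real) \<Rightarrow> bool" where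
  "unit_valued G n u \<longleftrightarrow> (\<forall>i\<in>states G n - target G. \<forall>g. u i g \<in> {0..1})"

lemma with_target_unit: "unit_valued G n u \<Longrightarrow> i \<in> states G n \<Longrightarrow> with_target G k u i g \<in> {0..1}"
  by (auto simp: unit_valued_def with_target_def)

lemma valid_gameD:
  assumes "valid_game G"
  shows "countable (states G n)" "target G \<noteq> {}" "i \<in> target G \<Longrightarrow> i \<in> states G n"
    "i \<in> states G n \<Longrightarrow> finite (avail G n k i)" "i \<in> states G n \<Longrightarrow> avail G n k i \<noteq> {}"
    "i \<in> states G n \<Longrightarrow> a \<in> joint_avail G n i \<Longrightarrow> j \<in> set_pmf (transit G n i a) \<Longrightarrow> j \<in> states G (Suc n)"
    "i \<in> states G n \<Longrightarrow> a \<in> joint_avail G n i \<Longrightarrow> 0 \<le> reward G n k i a"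
  using assms unfolding valid_game_def by blast+

lemma infsum_pmf:
  assumes "\<And>x. \<bar>f x\<bar> \<le> (1::real)"
  shows "(\<Sum>\<^sub>\<infinity>x. f x * pmf p x) = measure_pmf.expectation p f"
proof -
  have "Infinite_Set_Sum.abs_summable_on (\<lambda>x. pmf p x * f x) UNIV"
    by (rule abs_summable_on_comparison_test[of "pmf p"])
      (use assms in \<open>auto simp: abs_mult intro: mult_left_le pmf_abs_summable\<close>)
  then show ?thesis
    by (simp add: pmf_expectation_eq_infsetsum infsetsum_infsum mult.commute)
qed

text \<open>
  The two summands of \<open>T_act\<close> are the contributions of the target and of its complement to the mean of
  \<open>with_target\<close> at the next state.
\<close>

lemma T_act_eq_expectation:
  assumes G: "valid_game G" and i: "i \<in> states G n" "a \<in> joint_avail G n i" and u: "unit_valued G (Suc n) u"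
  shows "T_act G n k a u i g =
    (\<integral>j. with_target G k u j (\<lambda>l. g l - reward G n l i a) \<partial>measure_pmf (transit G n i a))"
proof -
  let ?g = "\<lambda>l. g l - reward G n l i a" and ?p = "transit G n i a" and ?D = "target G"
  let ?c = "of_bool (g k \<le> reward G n k i a) :: real"
  define v where "v j = (if j \<in> states G (Suc n) - ?D then u j ?g else 0)" for j
  have v: "\<bar>v j\<bar> \<le> 1" for j using u by (auto simp: v_def unit_valued_def)
  have "(\<Sum>\<^sub>\<infinity>j\<in>states G (Suc n) - ?D. u j ?g * pmf ?p j) = (\<Sum>\<^sub>\<infinity>j. v j * pmf ?p j)"
    by (rule infsum_cong_neutral) (auto simp: v_def)
  also have "\<dots> = measure_pmf.expectation ?p v"
    using v by (rule infsum_pmf)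
  finally have "T_act G n k a u i g = (\<integral>j. ?c * indicator ?D j \<partial>measure_pmf ?p) + measure_pmf.expectation ?p v"
    by (simp add: T_act_def)
  also have "\<dots> = (\<integral>j. ?c * indicator ?D j + v j \<partial>measure_pmf ?p)"
    using v by (subst Bochner_Integration.integral_add) (auto intro!: integrable_pmf_bounded[of _ _ 1] simp: indicator_def)
  also have "\<dots> = (\<integral>j. with_target G k u j ?g \<partial>measure_pmf ?p)"
    by (intro integral_cong_AE AE_pmfI)
      (use valid_gameD(6)[OF G i] in \<open>auto simp: v_def with_target_def indicator_def\<close>)
  finally show ?thesis .
qed

lemma finite_joint_avail: "valid_game G \<Longrightarrow> i \<in> states G n \<Longrightarrow> finite (joint_avail G n i)"
  for G :: "('s, 'a, 'k::finite) game"
  unfolding joint_avail_def by (intro finite_PiE valid_gameD(4)) auto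

lemma joint_in_joint_avail:
  fixes q :: "'k::finite \<Rightarrow> 'a pmf"
  assumes "\<And>l. set_pmf (q l) \<subseteq> avail G n l i" "a \<in> set_pmf (Pi_pmf UNIV undefined q)"
  shows "a \<in> joint_avail G n i"
proof -
  have "a l \<in> set_pmf (q l)" for l using assms(2) by (simp add: set_Pi_pmf PiE_dflt_def)
  then show ?thesis using assms(1) by (auto simp: joint_avail_def PiE_iff)
qed

lemma T_mix_eq_expectation:
  assumes G: "valid_game G" and i: "i \<in> states G n" and q: "\<And>l. set_pmf (q l) \<subseteq> avail G n l i"
  shows "T_mix G n k q u i g = (\<integral>a. T_act G n k a u i g \<partial>measure_pmf (Pi_pmf UNIV undefined q))"
  by (subst integral_measure_pmf_real[OF finite_joint_avail[OF G i]])
    (auto simp: T_mix_def pmf_Pi dest: joint_in_joint_avail[OF q])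

lemma T_mix_eq_next_expectation:
  assumes G: "valid_game G" and h: "cur_state h \<in> states G n"
    and \<pi>: "\<And>l. set_pmf (\<pi> l n h) \<subseteq> avail G n l (cur_state h)" and u: "unit_valued G (Suc n) u"
  shows "T_mix G n k (\<lambda>l. \<pi> l n h) u (cur_state h) (cur_goal h) =
    next_expectation G \<pi> n h (\<lambda>h'. with_target G k u (cur_state h') (cur_goal h'))"
  unfolding T_mix_eq_expectation[OF G h, of "\<lambda>l. \<pi> l n h", OF \<pi>] next_expectation_def
  by (intro integral_cong_AE AE_pmfI)
    (auto intro!: T_act_eq_expectation[OF G h _ u] joint_in_joint_avail[OF \<pi>])

lemma win_prob_bounds: "0 \<le> win_prob G \<pi> k n h" "win_prob G \<pi> k n h \<le> 1"
  by (simp_all add: win_prob_def prob_space.prob_le_1[OF prob_space_law])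

lemma survival_bounds: "0 \<le> survival G \<pi> m n h" "survival G \<pi> m n h \<le> 1"
  by (simp_all add: survival_def prob_space.prob_le_1[OF prob_space_law])

text \<open>
  A set of histories that is closed under the moves of the game, on which the policies are admissible and
  the target is hit almost surely.  Two instances are used: all proper histories, for arbitrary policies;
  and all histories, proper or not, whose last state is a state of the game, for Markov policies.  The
  second is needed because \<open>F\<close> starts Markov policies at time \<open>n\<close> with an empty past.
\<close>

locale absorbed_run =
  fixes G :: "('s, 'a, 'k::finite) game" and \<pi> :: "'k \<Rightarrow> ('s, 'a, 'k) policy"
    and R :: "nat \<Rightarrow> ('s, 'a, 'k) hist set"
  assumes valid: "valid_game G"
    and R_state: "h \<in> R n \<Longrightarrow> cur_state h \<in> states G n"
    and R_avail: "h \<in> R n \<Longrightarrow> set_pmf (\<pi> l n h) \<subseteq> avail G n l (cur_state h)"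
    and R_closed: "h \<in> R n \<Longrightarrow> a \<in> joint_avail G n (cur_state h) \<Longrightarrow> j \<in> states G (Suc n) \<Longrightarrow>
      extend_hist G n h a j \<in> R (Suc n)"
    and absorbed: "h \<in> R n \<Longrightarrow> cur_state h \<notin> target G \<Longrightarrow> (\<lambda>m. survival G \<pi> m n h) \<longlonglongrightarrow> 0"
begin

lemma joint_avail: "h \<in> R n \<Longrightarrow> a \<in> set_pmf (joint \<pi> n h) \<Longrightarrow> a \<in> joint_avail G n (cur_state h)"
  using R_avail by (rule joint_in_joint_avail)

lemma R_next:
  "h \<in> R n \<Longrightarrow> a \<in> set_pmf (joint \<pi> n h) \<Longrightarrow> j \<in> set_pmf (transit G n (cur_state h) a) \<Longrightarrow>
    extend_hist G n h a j \<in> R (Suc n)"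
  by (intro R_closed joint_avail valid_gameD(6)[OF valid R_state])

lemma win_prob_eq_next:
  "h \<in> R n \<Longrightarrow> cur_state h \<notin> target G \<Longrightarrow> win_prob G \<pi> k n h = next_expectation G \<pi> n h (win_prob G \<pi> k (Suc n))"
  unfolding next_expectation_def
  by (intro win_prob_first_step valid_gameD(7)[OF valid R_state] joint_avail)

lemma survival_eq_next:
  "cur_state h \<notin> target G \<Longrightarrow> survival G \<pi> (Suc m) n h = next_expectation G \<pi> n h (survival G \<pi> m (Suc n))"
  by (simp add: survival_Suc next_expectation_def)

context
  fixes u :: "nat \<Rightarrow> 's \<Rightarrow> ('k \<Rightarrow> rat) \<Rightarrow> real" and k :: 'k
  assumes u: "\<And>n. unit_valued G n (u n)"
begin

abbreviation w :: "nat \<Rightarrow> ('s, 'a, 'k) hist \<Rightarrow> real" where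
  "w n h \<equiv> with_target G k (u n) (cur_state h) (cur_goal h)"

lemma w_unit: "h \<in> R n \<Longrightarrow> w n h \<in> {0..1}"
  by (rule with_target_unit[OF u R_state])

lemma T_mix_eq_next:
  "h \<in> R n \<Longrightarrow> T_mix G n k (\<lambda>l. \<pi> l n h) (u (Suc n)) (cur_state h) (cur_goal h) = next_expectation G \<pi> n h (w (Suc n))"
  by (rule T_mix_eq_next_expectation[OF valid R_state R_avail u])

text \<open>
  By induction on \<open>m\<close>, the winning probability exceeds the supersolution by at most the \<open>m\<close>-step survival
  probability: for \<open>m = 0\<close> this bound is \<open>1\<close>, and the one-step recursions of the three terms carry it from
  \<open>m\<close> to \<open>m + 1\<close>.  Absorption then removes the error.
\<close>

lemma win_prob_le_supersolution:
  assumes super: "\<And>n h. h \<in> R n \<Longrightarrow> cur_state h \<notin> target G \<Longrightarrow>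
      T_mix G n k (\<lambda>l. \<pi> l n h) (u (Suc n)) (cur_state h) (cur_goal h) \<le> u n (cur_state h) (cur_goal h)"
    and h: "h \<in> R n" "cur_state h \<notin> target G"
  shows "win_prob G \<pi> k n h \<le> u n (cur_state h) (cur_goal h)"
proof -
  have "win_prob G \<pi> k n h \<le> w n h + survival G \<pi> m n h" if "h \<in> R n" for m n h
    using that
  proof (induction m arbitrary: n h)
    case 0
    then show ?case using w_unit[OF 0] win_prob_bounds(2)[of G \<pi> k n h] by (simp add: survival_0)
  next
    case (Suc m)
    show ?case
    proof (cases "cur_state h \<in> target G")
      case True
      then show ?thesis by (simp add: win_prob_target with_target_def survival_bounds)
    next
      case False
      have "win_prob G \<pi> k n h = next_expectation G \<pi> n h (win_prob G \<pi> k (Suc n))"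
        using Suc.prems False by (rule win_prob_eq_next)
      also have "\<dots> \<le> next_expectation G \<pi> n h (w (Suc n)) + next_expectation G \<pi> n h (survival G \<pi> m (Suc n))"
      proof (rule next_expectation_le_add)
        fix a j assume "a \<in> set_pmf (joint \<pi> n h)" "j \<in> set_pmf (transit G n (cur_state h) a)"
        then have "extend_hist G n h a j \<in> R (Suc n)" using Suc.prems by (intro R_next)
        from Suc.IH[OF this] w_unit[OF this]
        show "win_prob G \<pi> k (Suc n) (extend_hist G n h a j)
              \<le> w (Suc n) (extend_hist G n h a j) + survival G \<pi> m (Suc n) (extend_hist G n h a j) \<and>
            \<bar>win_prob G \<pi> k (Suc n) (extend_hist G n h a j)\<bar> \<le> 1 \<and>
            \<bar>w (Suc n) (extend_hist G n h a j)\<bar> \<le> 1 \<and> \<bar>survival G \<pi> m (Suc n) (extend_hist G n h a j)\<bar> \<le> 1"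
          by (simp add: win_prob_bounds survival_bounds del: cur_extend)
      qed
      also have "next_expectation G \<pi> n h (w (Suc n)) \<le> w n h"
        using super[OF Suc.prems False] False by (simp add: T_mix_eq_next[OF Suc.prems] with_target_def)
      finally show ?thesis using False by (simp add: survival_eq_next)
    qed
  qed
  from LIMSEQ_le_const[OF tendsto_add[OF tendsto_const absorbed[OF h]], of "win_prob G \<pi> k n h" "w n h"] this[OF h(1)]
  show ?thesis using h(2) by (simp add: with_target_def)
qed

text \<open>
  The same argument with the roles of the two functions exchanged.
\<close>

lemma subsolution_le_win_prob:
  assumes sub: "\<And>n h. h \<in> R n \<Longrightarrow> cur_state h \<notin> target G \<Longrightarrow>
      u n (cur_state h) (cur_goal h) \<le> T_mix G n k (\<lambda>l. \<pi> l n h) (u (Suc n)) (cur_state h) (cur_goal h)"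
    and h: "h \<in> R n" "cur_state h \<notin> target G"
  shows "u n (cur_state h) (cur_goal h) \<le> win_prob G \<pi> k n h"
proof -
  have "w n h \<le> win_prob G \<pi> k n h + survival G \<pi> m n h" if "h \<in> R n" for m n h
    using that
  proof (induction m arbitrary: n h)
    case 0
    then show ?case using w_unit[OF 0] win_prob_bounds(1)[of G \<pi> k n h] by (simp add: survival_0)
  next
    case (Suc m)
    show ?case
    proof (cases "cur_state h \<in> target G")
      case True
      then show ?thesis by (simp add: win_prob_target with_target_def survival_bounds)
    next
      case False
      have "w n h \<le> next_expectation G \<pi> n h (w (Suc n))"
        using sub[OF Suc.prems False] False by (simp add: T_mix_eq_next[OF Suc.prems] with_target_def)
      also have "\<dots> \<le> next_expectation G \<pi> n h (win_prob G \<pi> k (Suc n)) + next_expectation G \<pi> n h (survival G \<pi> m (Suc n))"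
      proof (rule next_expectation_le_add)
        fix a j assume "a \<in> set_pmf (joint \<pi> n h)" "j \<in> set_pmf (transit G n (cur_state h) a)"
        then have "extend_hist G n h a j \<in> R (Suc n)" using Suc.prems by (intro R_next)
        from Suc.IH[OF this] w_unit[OF this]
        show "w (Suc n) (extend_hist G n h a j)
              \<le> win_prob G \<pi> k (Suc n) (extend_hist G n h a j) + survival G \<pi> m (Suc n) (extend_hist G n h a j) \<and>
            \<bar>w (Suc n) (extend_hist G n h a j)\<bar> \<le> 1 \<and>
            \<bar>win_prob G \<pi> k (Suc n) (extend_hist G n h a j)\<bar> \<le> 1 \<and> \<bar>survival G \<pi> m (Suc n) (extend_hist G n h a j)\<bar> \<le> 1"
          by (simp add: win_prob_bounds survival_bounds del: cur_extend)
      qed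
      finally show ?thesis using False Suc.prems by (simp add: survival_eq_next win_prob_eq_next)
    qed
  qed
  from LIMSEQ_le_const[OF tendsto_add[OF tendsto_const absorbed[OF h]], of "w n h" "win_prob G \<pi> k n h"] this[OF h(1)]
  show ?thesis using h(2) by (simp add: with_target_def)
qed

end

end

lemma hists_state: "h \<in> hists G n \<Longrightarrow> cur_state h \<in> states G n"
  by (cases n) (auto simp: cur_state_def)

lemma extend_hist_in_hists:
  "h \<in> hists G n \<Longrightarrow> a \<in> joint_avail G n (cur_state h) \<Longrightarrow> j \<in> states G (Suc n) \<Longrightarrow>
    extend_hist G n h a j \<in> hists G (Suc n)"
  by (cases h) (auto simp: cur_state_def)

lemma markov_in_policies: "\<phi> \<in> markov_kernels G k \<Longrightarrow> markov \<phi> \<in> policies G k"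
  by (auto simp: markov_kernels_def policies_def markov_def dest: hists_state)

lemma absorbed_run_hists:
  assumes "valid_game G" "assumption_A G" "\<pi> \<in> multipolicies G"
  shows "absorbed_run G \<pi> (hists G)"
proof
  show "set_pmf (\<pi> l n h) \<subseteq> avail G n l (cur_state h)" if "h \<in> hists G n" for h n l
    using assms(3) that by (auto simp: multipolicies_def policies_def probs_on_def)
qed (use assms in \<open>simp_all add: hists_state extend_hist_in_hists survival_tendsto_0 del: hists.simps\<close>)

text \<open>
  Transitions of probability zero are allowed in histories, so every state of the game occurs at its time
  in some history, for instance in one that was in the target before.
\<close>

lemma ex_hist:
  assumes G: "valid_game G"
  shows "i \<in> states G n \<Longrightarrow> \<exists>past. (past, i, g) \<in> hists G n"
proof (induction n arbitrary: i g)
  case (Suc n)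
  obtain d where d: "d \<in> target G" using valid_gameD(2)[OF G] by blast
  then obtain past where "(past, d, undefined) \<in> hists G n"
    using Suc.IH[OF valid_gameD(3)[OF G d]] by blast
  moreover have "joint_avail G n d \<noteq> {}"
    using valid_gameD(5)[OF G valid_gameD(3)[OF G d]] by (auto simp: joint_avail_def PiE_eq_empty_iff)
  ultimately show ?case using Suc.prems by auto
qed simp

text \<open>
  Under Markov policies the future depends on the current state and goals only; in this way Assumption A,
  which speaks of proper histories, extends to a start with an arbitrary past.
\<close>

lemma survival_markov_cong:
  "cur_state h = cur_state h' \<Longrightarrow> cur_goal h = cur_goal h' \<Longrightarrow>
    survival G (\<lambda>l. markov (\<phi> l)) m n h = survival G (\<lambda>l. markov (\<phi> l)) m n h'"
proof (induction m arbitrary: n h h')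
  case (Suc m)
  have "survival G (\<lambda>l. markov (\<phi> l)) m (Suc n) (extend_hist G n h a j) =
      survival G (\<lambda>l. markov (\<phi> l)) m (Suc n) (extend_hist G n h' a j)" for a j
    by (rule Suc.IH) (simp_all add: Suc.prems)
  moreover have "joint (\<lambda>l. markov (\<phi> l)) n h = joint (\<lambda>l. markov (\<phi> l)) n h'"
    by (simp add: markov_def Suc.prems)
  ultimately show ?case by (simp add: survival_Suc Suc.prems)
qed (simp add: survival_0)

lemma absorbed_run_markov:
  fixes G :: "('s, 'a, 'k::finite) game"
  assumes G: "valid_game G" "assumption_A G" and \<phi>: "\<And>l. \<phi> l \<in> markov_kernels G l"
  shows "absorbed_run G (\<lambda>l. markov (\<phi> l)) (\<lambda>n. {h. cur_state h \<in> states G n})"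
proof
  show "set_pmf (markov (\<phi> l) n h) \<subseteq> avail G n l (cur_state h)" if "h \<in> {h. cur_state h \<in> states G n}" for h n l
    using that \<phi>[of l] by (auto simp: markov_kernels_def markov_def probs_on_def)
  fix h :: "('s, 'a, 'k) hist" and n assume h: "h \<in> {h. cur_state h \<in> states G n}" "cur_state h \<notin> target G"
  then obtain past where h': "(past, cur_state h, cur_goal h) \<in> hists G n"
    using ex_hist[OF G(1)] by blast
  have "(\<lambda>m. survival G (\<lambda>l. markov (\<phi> l)) m n (past, cur_state h, cur_goal h)) \<longlonglongrightarrow> 0"
    by (rule survival_tendsto_0[OF G(2) _ h'])
      (use \<phi> h(2) in \<open>auto simp: multipolicies_def cur_state_def markov_in_policies\<close>)
  then show "(\<lambda>m. survival G (\<lambda>l. markov (\<phi> l)) m n h) \<longlonglongrightarrow> 0"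
    by (subst survival_markov_cong[of _ "(past, cur_state h, cur_goal h)"]) (simp_all add: cur_state_def cur_goal_def)
qed (use G in auto)

section \<open>Best replies and the optimality equation\<close>

lemma T_mix_cong:
  assumes "\<And>j g. j \<in> states G (Suc n) - target G \<Longrightarrow> u j g = u' j g"
  shows "T_mix G n k q u i g = T_mix G n k q u' i g"
proof -
  have "T_act G n k a u i g = T_act G n k a u' i g" for a
    unfolding T_act_def by (intro arg_cong2[where f="(+)"] refl infsum_cong) (simp only: assms)
  then show ?thesis by (simp add: T_mix_def)
qed

lemma expectation_unit:
  fixes f :: "'x \<Rightarrow> real"
  assumes "\<And>x. x \<in> set_pmf p \<Longrightarrow> f x \<in> {0..1}"
  shows "measure_pmf.expectation p f \<in> {0..1}"
proof -
  have "0 \<le> measure_pmf.expectation p f"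
    by (intro integral_nonneg_AE AE_pmfI) (use assms in auto)
  moreover have "\<bar>measure_pmf.expectation p f\<bar> \<le> 1"
    by (intro abs_expectation_le) (use assms in force)
  ultimately show ?thesis by simp
qed

lemma T_mix_unit:
  assumes G: "valid_game G" and i: "i \<in> states G n" and q: "\<And>l. set_pmf (q l) \<subseteq> avail G n l i"
    and u: "unit_valued G (Suc n) u"
  shows "T_mix G n k q u i g \<in> {0..1}"
  unfolding T_mix_eq_expectation[OF G i q]
proof (rule expectation_unit)
  fix a assume "a \<in> set_pmf (Pi_pmf UNIV undefined q)"
  then have a: "a \<in> joint_avail G n i" by (rule joint_in_joint_avail[OF q])
  show "T_act G n k a u i g \<in> {0..1}"
    unfolding T_act_eq_expectation[OF G i a u]
    by (intro expectation_unit with_target_unit[OF u] valid_gameD(6)[OF G i a])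
qed

text \<open>
  Dominated convergence: pointwise convergence of the values is enough, which is what makes the operator
  continuous on the Hilbert cube.
\<close>

lemma T_act_tendsto:
  assumes G: "valid_game G" and i: "i \<in> states G n" "a \<in> joint_avail G n i"
    and U: "\<And>m. unit_valued G (Suc n) (U m)" and u: "unit_valued G (Suc n) u"
    and lim: "\<And>j g. j \<in> states G (Suc n) - target G \<Longrightarrow> (\<lambda>m. U m j g) \<longlonglongrightarrow> u j g"
  shows "(\<lambda>m. T_act G n k a (U m) i g) \<longlonglongrightarrow> T_act G n k a u i g"
  unfolding T_act_eq_expectation[OF G i U] T_act_eq_expectation[OF G i u]
proof (rule integral_dominated_convergence[where w="\<lambda>_. 1"])
  note next_state = valid_gameD(6)[OF G i]
  let ?g = "\<lambda>l. g l - reward G n l i a"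
  show "AE j in measure_pmf (transit G n i a). (\<lambda>m. with_target G k (U m) j ?g) \<longlonglongrightarrow> with_target G k u j ?g"
    by (rule AE_pmfI) (auto simp: with_target_def intro!: lim next_state)
  show "AE j in measure_pmf (transit G n i a). norm (with_target G k (U m) j ?g) \<le> 1" for m
    by (rule AE_pmfI) (use with_target_unit[OF U next_state] in auto)
qed auto

lemma T_mix_tendsto:
  assumes G: "valid_game G" and i: "i \<in> states G n"
    and q: "\<And>l b. (\<lambda>m. pmf (q m l) b) \<longlonglongrightarrow> pmf (q' l) b"
    and u: "\<And>m. unit_valued G (Suc n) (U m)" "unit_valued G (Suc n) u"
      "\<And>j g. j \<in> states G (Suc n) - target G \<Longrightarrow> (\<lambda>m. U m j g) \<longlonglongrightarrow> u j g"
  shows "(\<lambda>m. T_mix G n k (q m) (U m) i g) \<longlonglongrightarrow> T_mix G n k q' u i g"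
  unfolding T_mix_def
proof (intro tendsto_sum tendsto_mult tendsto_prod q)
  fix a assume "a \<in> joint_avail G n i"
  from G i this u show "(\<lambda>m. T_act G n k a (U m) i g) \<longlonglongrightarrow> T_act G n k a u i g"
    by (rule T_act_tendsto)
qed

text \<open>
  \<open>T_mix\<close> is affine in the mixed action of each player, so that its maximum over mixed actions is attained
  at a pure one.
\<close>

lemma T_mix_fun_upd:
  assumes G: "valid_game G" and i: "i \<in> states G n"
  shows "T_mix G n k (p(l := q)) u i g = (\<Sum>b\<in>avail G n l i. pmf q b * T_mix G n k (p(l := return_pmf b)) u i g)"
proof -
  let ?A = "avail G n l i"
  have split: "(\<Prod>m\<in>UNIV. pmf ((p(l := r)) m) (a m)) = pmf r (a l) * (\<Prod>m\<in>UNIV - {l}. pmf (p m) (a m))" for r a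
    by (subst prod.remove[of _ l]) (auto intro!: prod.cong)
  have one: "(\<Sum>b\<in>?A. pmf q b * pmf (return_pmf b) (a l)) = pmf q (a l)" if "a \<in> joint_avail G n i" for a
  proof -
    have "a l \<in> ?A" using that by (auto simp: joint_avail_def)
    then show ?thesis
      using valid_gameD(4)[OF G i] by (simp add: indicator_def sum.delta)
  qed
  have "(\<Sum>b\<in>?A. pmf q b * T_mix G n k (p(l := return_pmf b)) u i g) =
    (\<Sum>a\<in>joint_avail G n i. \<Sum>b\<in>?A. T_act G n k a u i g * ((pmf q b * pmf (return_pmf b) (a l)) * (\<Prod>m\<in>UNIV - {l}. pmf (p m) (a m))))"
    unfolding T_mix_def split sum_distrib_left by (subst sum.swap) (simp add: mult_ac)
  also have "\<dots> = T_mix G n k (p(l := q)) u i g"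
    unfolding T_mix_def split
  proof (intro sum.cong refl)
    fix a assume a: "a \<in> joint_avail G n i"
    let ?T = "T_act G n k a u i g" and ?P = "\<Prod>m\<in>UNIV - {l}. pmf (p m) (a m)"
    have "(\<Sum>b\<in>?A. ?T * ((pmf q b * pmf (return_pmf b) (a l)) * ?P)) =
        ?T * ((\<Sum>b\<in>?A. pmf q b * pmf (return_pmf b) (a l)) * ?P)"
      by (simp only: sum_distrib_left sum_distrib_right)
    then show "(\<Sum>b\<in>?A. ?T * ((pmf q b * pmf (return_pmf b) (a l)) * ?P)) = ?T * (pmf q (a l) * ?P)"
      by (simp only: one[OF a])
  qed
  finally show ?thesis ..
qed

lemma T_mix_fun_upd_le:
  assumes G: "valid_game G" and i: "i \<in> states G n" and q: "q \<in> probs_on (avail G n l i)"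
    and le: "\<And>b. b \<in> avail G n l i \<Longrightarrow> T_mix G n k (p(l := return_pmf b)) u i g \<le> c"
  shows "T_mix G n k (p(l := q)) u i g \<le> c"
proof -
  let ?A = "avail G n l i"
  have "T_mix G n k (p(l := q)) u i g \<le> (\<Sum>b\<in>?A. pmf q b * c)"
    unfolding T_mix_fun_upd[OF G i, where q=q] by (intro sum_mono mult_left_mono le) auto
  also have "\<dots> = c"
    using sum_pmf_eq_1[of ?A q] q valid_gameD(4)[OF G i] by (simp add: probs_on_def flip: sum_distrib_right)
  finally show ?thesis .
qed

lemma SUP_T_mix_eq:
  assumes G: "valid_game G" and i: "i \<in> states G n" and q: "q \<in> probs_on (avail G n k i)"
    and le: "\<And>b. b \<in> avail G n k i \<Longrightarrow>
      T_mix G n k (p(k := return_pmf b)) u i g \<le> T_mix G n k (p(k := q)) u i g"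
  shows "(SUP q\<in>probs_on (avail G n k i). T_mix G n k (p(k := q)) u i g) = T_mix G n k (p(k := q)) u i g"
proof (rule cSup_eq_maximum)
  fix x assume "x \<in> (\<lambda>q. T_mix G n k (p(k := q)) u i g) ` probs_on (avail G n k i)"
  then obtain q' where "q' \<in> probs_on (avail G n k i)" "x = T_mix G n k (p(k := q')) u i g" by blast
  then show "x \<le> T_mix G n k (p(k := q)) u i g"
    by (simp only: T_mix_fun_upd_le[OF G i _ le])
qed (rule imageI[OF q])

lemma ex_pure_best_reply:
  assumes G: "valid_game G" and i: "i \<in> states G n"
  shows "\<exists>b\<in>avail G n k i. \<forall>q\<in>probs_on (avail G n k i).
    T_mix G n k (p(k := q)) u i g \<le> T_mix G n k (p(k := return_pmf b)) u i g"
proof -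
  let ?A = "avail G n k i" and ?f = "\<lambda>b. T_mix G n k (p(k := return_pmf b)) u i g"
  have A: "finite (?f ` ?A)" "?f ` ?A \<noteq> {}" using valid_gameD(4,5)[OF G i] by auto
  then have "Max (?f ` ?A) \<in> ?f ` ?A" by (rule Max_in)
  then obtain b where b: "Max (?f ` ?A) = ?f b" "b \<in> ?A" by (rule imageE)
  from b(2) show ?thesis
  proof (intro bexI[of _ b] ballI)
    fix q assume q: "q \<in> probs_on ?A"
    show "T_mix G n k (p(k := q)) u i g \<le> ?f b"
    proof (rule T_mix_fun_upd_le[OF G i q])
      fix b' assume "b' \<in> ?A"
      then show "?f b' \<le> ?f b" using A(1) unfolding b(1)[symmetric] by (intro Max_ge imageI)
    qed
  qed
qed

text \<open>
  What a fixed point provides of \<open>optimality_solution\<close>: everything but the values at negative goals.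
\<close>

definition solves_optimality_equation ::
    "('s, 'a, 'k::finite) game \<Rightarrow> 'k \<Rightarrow> ('k \<Rightarrow> ('s, 'a, 'k) markov_kernel)
       \<Rightarrow> (nat \<Rightarrow> 's \<Rightarrow> ('k \<Rightarrow> rat) \<Rightarrow> real) \<Rightarrow> bool" where
  "solves_optimality_equation G k \<phi> u \<longleftrightarrow> (\<forall>n. unit_valued G n (u n)) \<and>
     (\<forall>n. \<forall>i\<in>states G n - target G. \<forall>g.
        u n i g = (SUP q\<in>probs_on (avail G n k i). T_mix G n k ((\<lambda>l. \<phi> l n i g)(k := q)) (u (Suc n)) i g))"

text \<open>
  A function that is consistent with Markov policies is both a subsolution and a supersolution for them.
\<close>

lemma F_markov_eq:
  fixes G :: "('s, 'a, 'k::finite) game"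
  assumes G: "valid_game G" "assumption_A G" and \<phi>: "\<And>l. \<phi> l \<in> markov_kernels G l"
    and u: "\<And>n. unit_valued G n (u n)"
    and eq: "\<And>n i g. i \<in> states G n - target G \<Longrightarrow> u n i g = T_mix G n k (\<lambda>l. \<phi> l n i g) (u (Suc n)) i g"
    and i: "i \<in> states G n - target G"
  shows "F G n k i g (\<lambda>l. markov (\<phi> l)) = u n i g"
proof -
  interpret absorbed_run G "\<lambda>l. markov (\<phi> l)" "\<lambda>n. {h. cur_state h \<in> states G n}"
    using G \<phi> by (rule absorbed_run_markov)
  let ?h = "([], i, g) :: ('s, 'a, 'k) hist"
  have h: "?h \<in> {h. cur_state h \<in> states G n}" "cur_state ?h \<notin> target G"
    using i by (auto simp: cur_state_def)
  have "T_mix G m k (\<lambda>l. markov (\<phi> l) m h) (u (Suc m)) (cur_state h) (cur_goal h) = u m (cur_state h) (cur_goal h)"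
    if "h \<in> {h. cur_state h \<in> states G m}" "cur_state h \<notin> target G" for m and h :: "('s, 'a, 'k) hist"
    using that by (simp add: markov_def eq)
  note one_step = eq_refl[OF this] eq_refl[OF this[symmetric]]
  have "win_prob G (\<lambda>l. markov (\<phi> l)) k n ?h \<le> u n (cur_state ?h) (cur_goal ?h)"
    by (rule win_prob_le_supersolution[OF u one_step(1) h])
  moreover have "u n (cur_state ?h) (cur_goal ?h) \<le> win_prob G (\<lambda>l. markov (\<phi> l)) k n ?h"
    by (rule subsolution_le_win_prob[OF u one_step(2) h])
  ultimately show ?thesis by (simp add: F_eq_win_prob cur_state_def cur_goal_def)
qed

text \<open>
  A solution is a supersolution for every policy of player \<open>k\<close>, hence an upper bound for \<open>Fhat\<close>.  It is
  consistent with the policy that plays a maximising action everywhere, so this policy attains the bound.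
\<close>

lemma solution_eq_Fhat:
  fixes G :: "('s, 'a, 'k::finite) game"
  assumes G: "valid_game G" "assumption_A G" and \<phi>: "\<And>l. \<phi> l \<in> markov_kernels G l"
    and sol: "solves_optimality_equation G k \<phi> u"
  shows "\<exists>\<phi>'\<in>markov_kernels G k. \<forall>n. \<forall>i\<in>states G n - target G. \<forall>g.
    u n i g = T_mix G n k ((\<lambda>l. \<phi> l n i g)(k := \<phi>' n i g)) (u (Suc n)) i g \<and>
    F G n k i g ((\<lambda>l. markov (\<phi> l))(k := markov \<phi>')) = u n i g \<and>
    Fhat G n k i g (\<lambda>l. markov (\<phi> l)) = u n i g"
proof -
  have u: "\<And>n. unit_valued G n (u n)"
    and eq: "\<And>n i g. i \<in> states G n - target G \<Longrightarrow>
      u n i g = (SUP q\<in>probs_on (avail G n k i). T_mix G n k ((\<lambda>l. \<phi> l n i g)(k := q)) (u (Suc n)) i g)"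
    using sol by (auto simp: solves_optimality_equation_def)
  define best where "best n i g = (SOME b. b \<in> avail G n k i \<and> (\<forall>q\<in>probs_on (avail G n k i).
    T_mix G n k ((\<lambda>l. \<phi> l n i g)(k := q)) (u (Suc n)) i g
      \<le> T_mix G n k ((\<lambda>l. \<phi> l n i g)(k := return_pmf b)) (u (Suc n)) i g))" for n i g
  have best: "best n i g \<in> avail G n k i" "\<And>q. q \<in> probs_on (avail G n k i) \<Longrightarrow>
    T_mix G n k ((\<lambda>l. \<phi> l n i g)(k := q)) (u (Suc n)) i g
      \<le> T_mix G n k ((\<lambda>l. \<phi> l n i g)(k := return_pmf (best n i g))) (u (Suc n)) i g" if "i \<in> states G n" for n i g
    using someI_ex[OF ex_pure_best_reply[OF G(1) that, unfolded Bex_def], of k "\<lambda>l. \<phi> l n i g" "u (Suc n)" g]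
    unfolding best_def by blast+
  define \<phi>' where "\<phi>' n i g = return_pmf (best n i g)" for n i g
  have \<phi>': "\<phi>' \<in> markov_kernels G k"
    by (auto simp: markov_kernels_def \<phi>'_def probs_on_def best)
  have eq': "u n i g = T_mix G n k ((\<lambda>l. \<phi> l n i g)(k := \<phi>' n i g)) (u (Suc n)) i g"
    if i: "i \<in> states G n - target G" for n i g
    unfolding eq[OF i] \<phi>'_def
  proof (rule SUP_T_mix_eq[OF G(1)])
    from i show i': "i \<in> states G n" by simp
    show "return_pmf (best n i g) \<in> probs_on (avail G n k i)"
      using best(1)[OF i'] by (simp add: probs_on_def)
    show "T_mix G n k ((\<lambda>l. \<phi> l n i g)(k := return_pmf b)) (u (Suc n)) i g
        \<le> T_mix G n k ((\<lambda>l. \<phi> l n i g)(k := return_pmf (best n i g))) (u (Suc n)) i g"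
      if "b \<in> avail G n k i" for b
      by (rule best(2)[OF i']) (use that in \<open>simp add: probs_on_def\<close>)
  qed
  have le: "T_mix G n k ((\<lambda>l. \<phi> l n i g)(k := q)) (u (Suc n)) i g \<le> u n i g"
    if i: "i \<in> states G n - target G" and q: "q \<in> probs_on (avail G n k i)" for n i g q
  proof -
    from i have "i \<in> states G n" by simp
    from best(2)[OF this q] show ?thesis by (simp only: eq'[OF i, of g] \<phi>'_def)
  qed
  have upd: "(\<lambda>l. markov ((\<phi>(k := \<theta>)) l)) = (\<lambda>l. markov (\<phi> l))(k := markov \<theta>)" for \<theta>
    by (rule ext) (simp add: fun_upd_apply split: if_split)
  have upd': "(\<lambda>l. (\<phi>(k := \<theta>)) l n i g) = (\<lambda>l. \<phi> l n i g)(k := \<theta> n i g)" for \<theta> n i g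
    by (rule ext) (simp add: fun_upd_apply split: if_split)
  have kernels: "(\<phi>(k := \<theta>)) l \<in> markov_kernels G l" if "\<theta> \<in> markov_kernels G k" for \<theta> l
    using \<phi> that by (cases "l = k") simp_all
  have att: "F G n k i g ((\<lambda>l. markov (\<phi> l))(k := markov \<phi>')) = u n i g"
    if i: "i \<in> states G n - target G" for n i g
  proof -
    have "F G n k i g (\<lambda>l. markov ((\<phi>(k := \<phi>')) l)) = u n i g"
      by (rule F_markov_eq[OF G kernels[OF \<phi>'] u _ i]) (simp only: upd' eq'[symmetric])
    then show ?thesis by (simp only: upd)
  qed
  have markov_le: "F G n k i g ((\<lambda>l. markov (\<phi> l))(k := markov \<theta>)) \<le> u n i g"
    if i: "i \<in> states G n - target G" and \<theta>: "\<theta> \<in> markov_kernels G k" for n i g \<theta>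
  proof -
    interpret absorbed_run G "\<lambda>l. markov ((\<phi>(k := \<theta>)) l)" "\<lambda>n. {h. cur_state h \<in> states G n}"
      by (rule absorbed_run_markov[OF G kernels[OF \<theta>]])
    let ?h = "([], i, g) :: ('s, 'a, 'k) hist"
    have "win_prob G (\<lambda>l. markov ((\<phi>(k := \<theta>)) l)) k n ?h \<le> u n (cur_state ?h) (cur_goal ?h)"
    proof (rule win_prob_le_supersolution[OF u])
      fix m and h :: "('s, 'a, 'k) hist" assume h: "h \<in> {h. cur_state h \<in> states G m}" "cur_state h \<notin> target G"
      then have "\<theta> m (cur_state h) (cur_goal h) \<in> probs_on (avail G m k (cur_state h))"
        using \<theta> by (simp add: markov_kernels_def)
      with h have "T_mix G m k ((\<lambda>l. \<phi> l m (cur_state h) (cur_goal h))(k := \<theta> m (cur_state h) (cur_goal h)))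
          (u (Suc m)) (cur_state h) (cur_goal h) \<le> u m (cur_state h) (cur_goal h)"
        by (intro le) simp_all
      then show "T_mix G m k (\<lambda>l. markov ((\<phi>(k := \<theta>)) l) m h) (u (Suc m)) (cur_state h) (cur_goal h) \<le> u m (cur_state h) (cur_goal h)"
        by (simp only: markov_def upd')
    qed (use i in \<open>simp_all add: cur_state_def\<close>)
    then show ?thesis by (simp only: F_eq_win_prob upd) (simp add: cur_state_def cur_goal_def)
  qed
  have policy_le: "F G 0 k i g ((\<lambda>l. markov (\<phi> l))(k := \<pi>')) \<le> u 0 i g"
    if i: "i \<in> states G 0 - target G" and \<pi>': "\<pi>' \<in> policies G k" for i g \<pi>'
  proof -
    let ?\<pi> = "(\<lambda>l. markov (\<phi> l))(k := \<pi>')"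
    have "?\<pi> \<in> multipolicies G"
      using \<phi> \<pi>' by (auto simp: multipolicies_def markov_in_policies)
    with G interpret absorbed_run G ?\<pi> "hists G" by (rule absorbed_run_hists)
    let ?h = "([], i, g) :: ('s, 'a, 'k) hist"
    have "win_prob G ?\<pi> k 0 ?h \<le> u 0 (cur_state ?h) (cur_goal ?h)"
    proof (rule win_prob_le_supersolution[OF u])
      fix m and h :: "('s, 'a, 'k) hist" assume h: "h \<in> hists G m" "cur_state h \<notin> target G"
      have "\<pi>' m h \<in> probs_on (avail G m k (cur_state h))"
        using \<pi>' h(1) by (simp add: policies_def)
      with h have "T_mix G m k ((\<lambda>l. \<phi> l m (cur_state h) (cur_goal h))(k := \<pi>' m h))
          (u (Suc m)) (cur_state h) (cur_goal h) \<le> u m (cur_state h) (cur_goal h)"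
        by (intro le) (simp_all add: hists_state)
      moreover have "(\<lambda>l. ?\<pi> l m h) = (\<lambda>l. \<phi> l m (cur_state h) (cur_goal h))(k := \<pi>' m h)"
        by (rule ext) (simp add: markov_def fun_upd_apply split: if_split)
      ultimately show "T_mix G m k (\<lambda>l. ?\<pi> l m h) (u (Suc m)) (cur_state h) (cur_goal h) \<le> u m (cur_state h) (cur_goal h)"
        by (simp only:)
    qed (use i in \<open>simp_all add: cur_state_def\<close>)
    then show ?thesis by (simp only: F_eq_win_prob) (simp add: cur_state_def cur_goal_def)
  qed
  have Fhat: "Fhat G n k i g (\<lambda>l. markov (\<phi> l)) = u n i g" if i: "i \<in> states G n - target G" for n i g
  proof (cases "n = 0")
    case True
    have "(SUP \<pi>'\<in>policies G k. F G 0 k i g ((\<lambda>l. markov (\<phi> l))(k := \<pi>'))) = u 0 i g"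
    proof (rule cSup_eq_maximum)
      show "u 0 i g \<in> (\<lambda>\<pi>'. F G 0 k i g ((\<lambda>l. markov (\<phi> l))(k := \<pi>'))) ` policies G k"
        using i True att[of i 0 g] by (intro image_eqI[OF _ markov_in_policies[OF \<phi>']]) simp
    qed (use i True policy_le[of i] in blast)
    then show ?thesis by (simp add: Fhat_def True)
  next
    case False
    have "(SUP \<pi>'\<in>markov_policies G k. F G n k i g ((\<lambda>l. markov (\<phi> l))(k := \<pi>'))) = u n i g"
    proof (rule cSup_eq_maximum)
      show "u n i g \<in> (\<lambda>\<pi>'. F G n k i g ((\<lambda>l. markov (\<phi> l))(k := \<pi>'))) ` markov_policies G k"
        unfolding markov_policies_def using att[OF i, of g] by (intro image_eqI[OF _ imageI[OF \<phi>']]) simp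
    qed (use markov_le[OF i] in \<open>unfold markov_policies_def, blast\<close>)
    then show ?thesis by (simp add: Fhat_def False)
  qed
  show ?thesis using \<phi>' eq' att Fhat by blast
qed

text \<open>
  A retraction of the cube \<open>[0,1]\<^sup>A\<close> onto the probability vectors on \<open>A\<close>: too much mass is scaled down, and
  missing mass is spread evenly.  It does not change vectors of mass \<open>1\<close>.
\<close>

definition to_pmf :: "'a set \<Rightarrow> ('a \<Rightarrow> real) \<Rightarrow> 'a pmf" where
  "to_pmf A c = embed_pmf (\<lambda>a. if a \<in> A
     then c a / max 1 (sum c A) + (1 - sum c A / max 1 (sum c A)) / real (card A) else 0)"

lemma pmf_to_pmf:
  assumes A: "finite A" "A \<noteq> {}" and c: "\<And>a. 0 \<le> c a"
  shows "pmf (to_pmf A c) a = (if a \<in> A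
     then c a / max 1 (sum c A) + (1 - sum c A / max 1 (sum c A)) / real (card A) else 0)"
  unfolding to_pmf_def
proof (rule pmf_embed_pmf)
  let ?w = "\<lambda>a. if a \<in> A then c a / max 1 (sum c A) + (1 - sum c A / max 1 (sum c A)) / real (card A) else 0"
  have "sum c A / max 1 (sum c A) \<le> 1" by (simp add: divide_le_eq)
  then have "0 \<le> c a / max 1 (sum c A) + (1 - sum c A / max 1 (sum c A)) / real (card A)" for a
    by (intro add_nonneg_nonneg divide_nonneg_nonneg) (simp_all add: c)
  then show w: "0 \<le> ?w a" for a by simp
  have "(\<integral>\<^sup>+a. ennreal (?w a) \<partial>count_space UNIV) = (\<Sum>a\<in>A. ennreal (?w a))"
    by (rule nn_integral_count_space') (use A in auto)
  also have "\<dots> = ennreal (\<Sum>a\<in>A. ?w a)"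
    by (rule sum_ennreal) (rule w)
  also have "(\<Sum>a\<in>A. ?w a) = 1"
    using A by (simp add: sum.distrib flip: sum_divide_distrib)
  finally show "(\<integral>\<^sup>+a. ennreal (?w a) \<partial>count_space UNIV) = 1" by simp
qed

lemma set_to_pmf: "finite A \<Longrightarrow> A \<noteq> {} \<Longrightarrow> (\<And>a. 0 \<le> c a) \<Longrightarrow> set_pmf (to_pmf A c) \<subseteq> A"
  by (auto simp: set_pmf_eq pmf_to_pmf split: if_splits)

lemma pmf_to_pmf_tendsto:
  assumes "finite A" "A \<noteq> {}" "\<And>m a. 0 \<le> C m a" "\<And>a. 0 \<le> c a" "\<And>a. (\<lambda>m. C m a) \<longlonglongrightarrow> c a"
  shows "(\<lambda>m. pmf (to_pmf A (C m)) a) \<longlonglongrightarrow> pmf (to_pmf A c) a"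
proof (cases "a \<in> A")
  case True
  have "(\<lambda>m. C m a / max 1 (sum (C m) A) + (1 - sum (C m) A / max 1 (sum (C m) A)) / real (card A))
      \<longlonglongrightarrow> c a / max 1 (sum c A) + (1 - sum c A / max 1 (sum c A)) / real (card A)"
    by (intro tendsto_add tendsto_divide tendsto_diff tendsto_max tendsto_sum tendsto_const assms(5))
      (use assms(1,2) in auto)
  then show ?thesis using True by (simp add: pmf_to_pmf assms)
qed (simp add: pmf_to_pmf assms)

text \<open>
  At a fixed point of Nash's map \<open>p\<close> is proportional to the positive parts of the advantages of the actions
  over the mean payoff.  The mean advantage is zero, therefore so is the sum of the squares of the positive
  parts.
\<close>

lemma nash_map_fixed_point:
  fixes p Q :: "'a \<Rightarrow> real"
  assumes A: "finite A" and p: "sum p A = 1"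
    and fixed: "\<And>a. a \<in> A \<Longrightarrow>
      p a * (\<Sum>b\<in>A. max 0 (Q b - (\<Sum>c\<in>A. p c * Q c))) = max 0 (Q a - (\<Sum>c\<in>A. p c * Q c))"
    and a: "a \<in> A"
  shows "Q a \<le> (\<Sum>c\<in>A. p c * Q c)"
proof -
  define v where "v = (\<Sum>c\<in>A. p c * Q c)"
  define gain where "gain b = max 0 (Q b - v)" for b
  have "(\<Sum>b\<in>A. gain b * gain b) = (\<Sum>b\<in>A. gain b * (Q b - v))"
    by (intro sum.cong) (auto simp: gain_def max_def)
  also have "\<dots> = (\<Sum>b\<in>A. sum gain A * (p b * Q b - p b * v))"
    using fixed by (intro sum.cong) (auto simp: gain_def v_def algebra_simps)
  also have "\<dots> = 0"
    using p by (simp add: v_def sum_subtractf flip: sum_distrib_left sum_distrib_right)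
  finally have "gain a * gain a = 0"
    using A a by (subst (asm) sum_nonneg_eq_0_iff) auto
  then show ?thesis by (simp add: gain_def v_def max_def split: if_splits)
qed

section \<open>Fixed points and equilibria\<close>

text \<open>
  Indices of the unknowns: \<open>(k, n, i, g, None)\<close> stands for the value of player \<open>k\<close> at time \<open>n\<close> in state \<open>i\<close>
  with goals \<open>g\<close>, and \<open>(k, n, i, g, Some a)\<close> for the weight that player \<open>k\<close> puts on action \<open>a\<close> there.
\<close>

type_synonym ('s, 'a, 'k) coordinate = "'k \<times> nat \<times> 's \<times> ('k \<Rightarrow> rat) \<times> 'a option"

text \<open>
  The players in \<open>C\<close> respond to each other, the others follow \<open>\<phi>\<close>.  In the proof \<open>val\<close> is the one-step
  evaluation of the strategies \<open>\<psi> c\<close> with continuation values \<open>v c\<close>, and \<open>dev\<close> is the evaluation after a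
  deviation to a pure action.  Making the continuation values unknowns of their own keeps the map
  continuous without any uniform control of the hitting times.
\<close>

theorem ex_equilibrium_values:
  fixes G :: "('s, 'a, 'k::finite) game"
  assumes G: "valid_game G" and \<phi>: "\<And>l. \<phi> l \<in> markov_kernels G l"
  shows "\<exists>\<psi> v. (\<forall>l. \<psi> l \<in> markov_kernels G l) \<and> (\<forall>l. l \<notin> C \<longrightarrow> \<psi> l = \<phi> l) \<and>
    (\<forall>k n. unit_valued G n (v k n)) \<and>
    (\<forall>k\<in>C. \<forall>n. \<forall>i\<in>states G n - target G. \<forall>g.
      v k n i g = T_mix G n k (\<lambda>l. \<psi> l n i g) (v k (Suc n)) i g \<and>
      (\<forall>b\<in>avail G n k i. T_mix G n k ((\<lambda>l. \<psi> l n i g)(k := return_pmf b)) (v k (Suc n)) i g \<le> v k n i g))"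
proof -
  let ?S = "\<lambda>n. states G n - target G"
  define J :: "('s, 'a, 'k) coordinate set" where
    "J = (SIGMA k:UNIV. SIGMA n:UNIV. SIGMA i:?S n. SIGMA g:UNIV. insert None (Some ` avail G n k i))"
  define \<psi> where "\<psi> c l n i g = (if l \<in> C \<and> i \<in> ?S n then to_pmf (avail G n l i) (\<lambda>a. c (l, n, i, g, Some a)) else \<phi> l n i g)"
    for c :: "('s, 'a, 'k) coordinate \<Rightarrow> real" and l n i g
  define v where "v c k n i g = c (k, n, i, g, None)"
    for c :: "('s, 'a, 'k) coordinate \<Rightarrow> real" and k n i g
  define val where "val c k n i g = T_mix G n k (\<lambda>l. \<psi> c l n i g) (v c k (Suc n)) i g" for c k n i g
  define dev where "dev c k n i g b = T_mix G n k ((\<lambda>l. \<psi> c l n i g)(k := return_pmf b)) (v c k (Suc n)) i g" for c k n i g b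
  define regret where "regret c k n i g b = max 0 (dev c k n i g b - val c k n i g)" for c k n i g b
  define f where "f c = (\<lambda>(k, n, i, g, o'). case o' of None \<Rightarrow> val c k n i g
    | Some a \<Rightarrow> (pmf (\<psi> c k n i g) a + regret c k n i g a) / (1 + (\<Sum>b\<in>avail G n k i. regret c k n i g b)))" for c

  have avail: "finite (avail G n l i)" "avail G n l i \<noteq> {}" if "i \<in> ?S n" for n l i
    using valid_gameD(4,5)[OF G, of i n l] that by auto
  have \<psi>_kernel: "\<psi> c l \<in> markov_kernels G l" if c: "\<And>j. c j \<in> {0..1}" for c l
    unfolding markov_kernels_def probs_on_def
  proof (intro CollectI allI ballI)
    fix n i g assume i: "i \<in> states G n"
    show "set_pmf (\<psi> c l n i g) \<subseteq> avail G n l i"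
    proof (cases "l \<in> C \<and> i \<in> ?S n")
      case True
      then have "set_pmf (to_pmf (avail G n l i) (\<lambda>a. c (l, n, i, g, Some a))) \<subseteq> avail G n l i"
        using avail[of i n l] c by (intro set_to_pmf) simp_all
      with True show ?thesis by (simp add: \<psi>_def)
    next
      case False
      then show ?thesis using \<phi>[of l] i by (simp add: \<psi>_def markov_kernels_def probs_on_def if_not_P)
    qed
  qed
  then have \<psi>_avail: "set_pmf (\<psi> c l n i g) \<subseteq> avail G n l i"
    if "\<And>j. c j \<in> {0..1}" "i \<in> ?S n" for c l n i g
    using that by (simp add: markov_kernels_def probs_on_def)
  have v_unit: "unit_valued G n (v c k n)" if "\<And>j. c j \<in> {0..1}" for c k n
    using that by (simp add: unit_valued_def v_def)
  have val_unit: "val c k n i g \<in> {0..1}" if c: "\<And>j. c j \<in> {0..1}" and i: "i \<in> ?S n" for c k n i g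
    unfolding val_def by (rule T_mix_unit[OF G _ \<psi>_avail[OF c i] v_unit[OF c]]) (use i in simp)
  have regret_nonneg: "0 \<le> regret c k n i g b" for c k n i g b
    by (simp add: regret_def)

  have "\<exists>c. (\<forall>j. c j \<in> {0..1}) \<and> (\<forall>j\<in>J. f c j = c j)"
  proof (rule countable_cube_fixed_point)
    have "countable (?S n)" for n
      by (intro countable_Diff valid_gameD(1)[OF G])
    moreover have "countable (avail G n k i)" if "i \<in> ?S n" for n k i
      by (rule countable_finite[OF avail(1)[OF that]])
    ultimately show "countable J"
      unfolding J_def by (intro countable_SIGMA countable_insert countable_image) simp_all
  next
    fix c :: "('s, 'a, 'k) coordinate \<Rightarrow> real" and j assume c: "\<And>j. c j \<in> {0..1::real}" and "j \<in> J"
    then obtain k n i g o' where j: "j = (k, n, i, g, o')" and i: "i \<in> ?S n"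
      and o': "o' \<in> insert None (Some ` avail G n k i)"
      by (auto simp: J_def)
    show "f c j \<in> {0..1}"
    proof (cases o')
      case None
      then show ?thesis using val_unit[OF c i] by (simp add: f_def j)
    next
      case (Some a)
      let ?r = "regret c k n i g"
      have "a \<in> avail G n k i" using o' Some by auto
      then have "?r a \<le> (\<Sum>b\<in>avail G n k i. ?r b)"
        by (intro member_le_sum regret_nonneg avail[OF i])
      moreover have "0 \<le> (\<Sum>b\<in>avail G n k i. ?r b)"
        by (intro sum_nonneg regret_nonneg)
      ultimately show ?thesis
        using pmf_le_1[of "\<psi> c k n i g" a] regret_nonneg[of c k n i g a]
        by (simp add: f_def j Some divide_le_eq)
    qed
  next
    fix X :: "nat \<Rightarrow> ('s, 'a, 'k) coordinate \<Rightarrow> real" and c j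
    assume X: "\<And>m j. X m j \<in> {0..1::real}" and c: "\<And>j. c j \<in> {0..1::real}"
      and lim: "\<And>j. (\<lambda>m. X m j) \<longlonglongrightarrow> c j" and "j \<in> J"
    then obtain k n i g o' where j: "j = (k, n, i, g, o')" and i: "i \<in> ?S n"
      by (auto simp: J_def)
    have \<psi>_lim: "(\<lambda>m. pmf (\<psi> (X m) l n i g) b) \<longlonglongrightarrow> pmf (\<psi> c l n i g) b" for l b
    proof (cases "l \<in> C")
      case True
      have "(\<lambda>m. pmf (to_pmf (avail G n l i) (\<lambda>a. X m (l, n, i, g, Some a))) b)
          \<longlonglongrightarrow> pmf (to_pmf (avail G n l i) (\<lambda>a. c (l, n, i, g, Some a))) b"
        using X c by (intro pmf_to_pmf_tendsto avail[OF i] lim) simp_all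
      then show ?thesis using True i by (simp add: \<psi>_def)
    qed (simp add: \<psi>_def)
    have v_lim: "(\<lambda>m. v (X m) k (Suc n) j g) \<longlonglongrightarrow> v c k (Suc n) j g" for j g
      unfolding v_def by (rule lim)
    have i': "i \<in> states G n" using i by simp
    have val_lim: "(\<lambda>m. val (X m) k n i g) \<longlonglongrightarrow> val c k n i g"
      unfolding val_def by (rule T_mix_tendsto[OF G i' \<psi>_lim v_unit[OF X] v_unit[OF c] v_lim])
    have dev_lim: "(\<lambda>m. dev (X m) k n i g b) \<longlonglongrightarrow> dev c k n i g b" for b
      unfolding dev_def
    proof (rule T_mix_tendsto[OF G i' _ v_unit[OF X] v_unit[OF c] v_lim])
      show "(\<lambda>m. pmf (((\<lambda>l. \<psi> (X m) l n i g)(k := return_pmf b)) l) a)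
          \<longlonglongrightarrow> pmf (((\<lambda>l. \<psi> c l n i g)(k := return_pmf b)) l) a" for l a
        using \<psi>_lim by (cases "l = k") simp_all
    qed
    have regret_lim: "(\<lambda>m. regret (X m) k n i g b) \<longlonglongrightarrow> regret c k n i g b" for b
      unfolding regret_def by (intro tendsto_max tendsto_diff tendsto_const dev_lim val_lim)
    show "(\<lambda>m. f (X m) j) \<longlonglongrightarrow> f c j"
    proof (cases o')
      case None
      then show ?thesis using val_lim by (simp add: f_def j)
    next
      case (Some a)
      have "0 \<le> (\<Sum>b\<in>avail G n k i. regret c k n i g b)"
        by (intro sum_nonneg regret_nonneg)
      then have "1 + (\<Sum>b\<in>avail G n k i. regret c k n i g b) \<noteq> 0" by linarith
      then have "(\<lambda>m. (pmf (\<psi> (X m) k n i g) a + regret (X m) k n i g a) / (1 + (\<Sum>b\<in>avail G n k i. regret (X m) k n i g b)))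
        \<longlonglongrightarrow> (pmf (\<psi> c k n i g) a + regret c k n i g a) / (1 + (\<Sum>b\<in>avail G n k i. regret c k n i g b))"
        by (intro tendsto_divide tendsto_add tendsto_sum tendsto_const \<psi>_lim regret_lim)
      then show ?thesis by (simp add: f_def j Some)
    qed
  qed
  then obtain c where c: "\<And>j. c j \<in> {0..1}" and fixed: "\<And>j. j \<in> J \<Longrightarrow> f c j = c j" by blast

  have v_eq: "v c k n i g = val c k n i g" if "i \<in> ?S n" for k n i g
    using fixed[of "(k, n, i, g, None)"] that by (simp add: J_def f_def v_def)
  have no_gain: "dev c k n i g b \<le> v c k n i g"
    if k: "k \<in> C" and i: "i \<in> ?S n" and b: "b \<in> avail G n k i" for k n i g b
  proof -
    let ?A = "avail G n k i" and ?r = "regret c k n i g" and ?w = "\<lambda>a. c (k, n, i, g, Some a)"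
    let ?p = "pmf (\<psi> c k n i g)" and ?R = "\<Sum>b\<in>avail G n k i. regret c k n i g b"
    have R: "0 \<le> ?R" by (intro sum_nonneg regret_nonneg)
    have p1: "sum ?p ?A = 1"
      by (rule sum_pmf_eq_1[OF avail(1)[OF i] \<psi>_avail[OF c i]])
    have fixed_a: "(?p a + ?r a) / (1 + ?R) = ?w a" if "a \<in> ?A" for a
      using fixed[of "(k, n, i, g, Some a)"] i that by (simp add: J_def f_def)
    \<comment> \<open>The weights at the fixed point have mass \<open>1\<close>, so the retraction has not changed them.\<close>
    have "sum ?w ?A = (\<Sum>a\<in>?A. (?p a + ?r a) / (1 + ?R))"
      by (intro sum.cong refl) (simp only: fixed_a)
    also have "\<dots> = 1"
      using p1 R by (simp add: sum.distrib flip: sum_divide_distrib)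
    finally have "?p a = ?w a" if "a \<in> ?A" for a
      using that k i c by (simp add: \<psi>_def pmf_to_pmf[OF avail[OF i]])
    then have "(?p a + ?r a) / (1 + ?R) = ?p a" if "a \<in> ?A" for a
      using fixed_a[OF that] that by simp
    then have balance: "?p a * ?R = ?r a" if "a \<in> ?A" for a
      using that R by (simp add: divide_eq_eq algebra_simps split: if_splits)
    have i': "i \<in> states G n" using i by simp
    have upd: "(\<lambda>l. \<psi> c l n i g)(k := \<psi> c k n i g) = (\<lambda>l. \<psi> c l n i g)" by (rule fun_upd_triv)
    have val_sum: "val c k n i g = (\<Sum>a\<in>?A. ?p a * dev c k n i g a)"
      unfolding val_def dev_def T_mix_fun_upd[OF G i', symmetric] upd ..
    have "dev c k n i g b \<le> (\<Sum>a\<in>?A. ?p a * dev c k n i g a)"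
      by (rule nash_map_fixed_point[OF avail(1)[OF i] p1 _ b])
        (use balance in \<open>simp only: regret_def val_sum\<close>)
    then show ?thesis by (simp only: v_eq[OF i] val_sum)
  qed
  show ?thesis
  proof (intro exI[of _ "\<psi> c"] exI[of _ "v c"] conjI allI ballI impI)
    show "\<psi> c l \<in> markov_kernels G l" for l using c by (rule \<psi>_kernel)
    show "\<psi> c l = \<phi> l" if "l \<notin> C" for l using that by (intro ext) (simp add: \<psi>_def)
    show "unit_valued G n (v c k n)" for k n using c by (rule v_unit)
  next
    fix k n i g assume k: "k \<in> C" and i: "i \<in> ?S n"
    show "v c k n i g = T_mix G n k (\<lambda>l. \<psi> c l n i g) (v c k (Suc n)) i g"
      using v_eq[OF i] by (simp only: val_def)
    show "T_mix G n k ((\<lambda>l. \<psi> c l n i g)(k := return_pmf b)) (v c k (Suc n)) i g \<le> v c k n i g"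
      if "b \<in> avail G n k i" for b
      using no_gain[OF k i that] by (simp only: dev_def)
  qed
qed

text \<open>
  Since \<open>T_mix\<close> is affine in the mixed action of player \<open>k\<close>, the absence of profitable pure deviations means
  that the supremum over all mixed actions is attained at \<open>\<psi> k\<close>.
\<close>

lemma equilibrium_value_solves:
  assumes G: "valid_game G" and \<psi>: "\<psi> k \<in> markov_kernels G k"
    and unit: "\<And>n. unit_valued G n (u n)"
    and eq: "\<And>n i g. i \<in> states G n - target G \<Longrightarrow> u n i g = T_mix G n k (\<lambda>l. \<psi> l n i g) (u (Suc n)) i g"
    and le: "\<And>n i g b. i \<in> states G n - target G \<Longrightarrow> b \<in> avail G n k i \<Longrightarrow>
      T_mix G n k ((\<lambda>l. \<psi> l n i g)(k := return_pmf b)) (u (Suc n)) i g \<le> u n i g"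
  shows "solves_optimality_equation G k \<psi> u"
  unfolding solves_optimality_equation_def
proof (intro conjI allI ballI unit)
  fix n i g assume i: "i \<in> states G n - target G"
  then have i': "i \<in> states G n" by simp
  have upd: "(\<lambda>l. \<psi> l n i g)(k := \<psi> k n i g) = (\<lambda>l. \<psi> l n i g)" by (rule fun_upd_triv)
  have "(SUP q\<in>probs_on (avail G n k i). T_mix G n k ((\<lambda>l. \<psi> l n i g)(k := q)) (u (Suc n)) i g) =
      T_mix G n k ((\<lambda>l. \<psi> l n i g)(k := \<psi> k n i g)) (u (Suc n)) i g"
  proof (rule SUP_T_mix_eq[OF G i'])
    show "\<psi> k n i g \<in> probs_on (avail G n k i)" using \<psi> i' by (simp add: markov_kernels_def)
    show "T_mix G n k ((\<lambda>l. \<psi> l n i g)(k := return_pmf b)) (u (Suc n)) i g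
        \<le> T_mix G n k ((\<lambda>l. \<psi> l n i g)(k := \<psi> k n i g)) (u (Suc n)) i g" if "b \<in> avail G n k i" for b
      using le[OF i that] by (simp only: upd eq[OF i, symmetric])
  qed
  then show "u n i g = (SUP q\<in>probs_on (avail G n k i). T_mix G n k ((\<lambda>l. \<psi> l n i g)(k := q)) (u (Suc n)) i g)"
    by (simp only: upd eq[OF i, symmetric])
qed

lemma F_eq_1_of_nonpos: "g k \<le> 0 \<Longrightarrow> F G n k i g \<pi> = 1"
proof -
  assume "g k \<le> 0"
  then have "goal_event G n k (g k) = UNIV"
    by (auto simp: goal_event_def intro: order_trans[of _ 0] enn2ereal_nonneg)
  then show ?thesis
    using prob_space.prob_space[OF prob_space_law, of G \<pi> n "([], i, g)"]
    by (simp add: F_eq_win_prob win_prob_def cur_goal_def)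
qed

lemma solves_optimality_equation_iff:
  assumes "\<And>n i g. i \<in> states G n - target G \<Longrightarrow> u n i g = u' n i g"
  shows "solves_optimality_equation G k \<phi> u \<longleftrightarrow> solves_optimality_equation G k \<phi> u'"
proof -
  have "unit_valued G n (u n) \<longleftrightarrow> unit_valued G n (u' n)" for n
    using assms by (simp add: unit_valued_def)
  moreover have "T_mix G n k q (u (Suc n)) i g = T_mix G n k q (u' (Suc n)) i g" for n q i g
    using assms by (rule T_mix_cong)
  ultimately show ?thesis
    unfolding solves_optimality_equation_def
    by (intro arg_cong2[where f="(\<and>)"] all_cong1 ball_cong refl) (simp_all add: assms)
qed

theorem optimality_equation:
  fixes G :: "('s, 'a, 'k::finite) game"
  assumes G: "valid_game G" "assumption_A G" and \<phi>: "\<And>l. \<phi> l \<in> markov_kernels G l"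
  shows "optimality_solution G k \<phi> (\<lambda>n i g. Fhat G n k i g (\<lambda>l. markov (\<phi> l)))"
    and "optimality_solution G k \<phi> u \<Longrightarrow> i \<in> states G n - target G \<Longrightarrow>
      u n i g = Fhat G n k i g (\<lambda>l. markov (\<phi> l))"
    and "\<exists>\<phi>'\<in>markov_kernels G k. \<forall>n. \<forall>i\<in>states G n - target G. \<forall>g.
      Fhat G n k i g (\<lambda>l. markov (\<phi> l)) =
        T_mix G n k ((\<lambda>l. \<phi> l n i g)(k := \<phi>' n i g))
          (\<lambda>j g'. Fhat G (Suc n) k j g' (\<lambda>l. markov (\<phi> l))) i g"
proof -
  let ?V = "\<lambda>n i g. Fhat G n k i g (\<lambda>l. markov (\<phi> l))"
  obtain \<psi> v where "\<forall>l. \<psi> l \<in> markov_kernels G l" "\<forall>l. l \<notin> {k} \<longrightarrow> \<psi> l = \<phi> l" "\<forall>k n. unit_valued G n (v k n)"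
    and equilibrium: "\<forall>k\<in>{k}. \<forall>n. \<forall>i\<in>states G n - target G. \<forall>g.
      v k n i g = T_mix G n k (\<lambda>l. \<psi> l n i g) (v k (Suc n)) i g \<and>
      (\<forall>b\<in>avail G n k i. T_mix G n k ((\<lambda>l. \<psi> l n i g)(k := return_pmf b)) (v k (Suc n)) i g \<le> v k n i g)"
    using ex_equilibrium_values[OF G(1) \<phi>, of "{k}"] by (elim exE conjE)
  then have \<psi>: "\<And>l. \<psi> l \<in> markov_kernels G l" "\<And>l. l \<noteq> k \<Longrightarrow> \<psi> l = \<phi> l" and unit: "\<And>n. unit_valued G n (v k n)"
    by simp_all
  note v = unit equilibrium[rule_format, OF singletonI, THEN conjunct1] equilibrium[rule_format, OF singletonI, THEN conjunct2, rule_format]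
  have "solves_optimality_equation G k \<psi> (v k)"
    by (rule equilibrium_value_solves[OF G(1) \<psi>(1) v])
  moreover have "(\<lambda>l. \<psi> l n i g)(k := q) = (\<lambda>l. \<phi> l n i g)(k := q)" for n i g q
    using \<psi>(2) by (intro ext) (simp add: fun_upd_apply)
  ultimately have sol: "solves_optimality_equation G k \<phi> (v k)"
    by (simp only: solves_optimality_equation_def simp_thms) (elim conjE, assumption)
  obtain \<phi>' where \<phi>': "\<phi>' \<in> markov_kernels G k"
    and att: "\<And>n i g. i \<in> states G n - target G \<Longrightarrow>
      v k n i g = T_mix G n k ((\<lambda>l. \<phi> l n i g)(k := \<phi>' n i g)) (v k (Suc n)) i g"
    and F: "\<And>n i g. i \<in> states G n - target G \<Longrightarrow> F G n k i g ((\<lambda>l. markov (\<phi> l))(k := markov \<phi>')) = v k n i g"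
    and V: "\<And>n i g. i \<in> states G n - target G \<Longrightarrow> ?V n i g = v k n i g"
    using solution_eq_Fhat[OF G \<phi> sol] by blast
  have solV: "solves_optimality_equation G k \<phi> ?V"
    by (rule solves_optimality_equation_iff[THEN iffD2, OF _ sol]) (rule V)
  have "?V n \<in> \<U> G n k" for n
  proof -
    have "?V n i g = 1" if "i \<in> states G n - target G" "g k < 0" for i g
    proof -
      have "v k n i g = F G n k i g ((\<lambda>l. markov (\<phi> l))(k := markov \<phi>'))"
        by (rule F[OF that(1), symmetric])
      also have "\<dots> = 1" using that(2) by (intro F_eq_1_of_nonpos) simp
      finally show ?thesis by (simp only: V[OF that(1)])
    qed
    moreover have "unit_valued G n (?V n)"
      using solV by (simp add: solves_optimality_equation_def)
    ultimately show ?thesis by (simp add: \<U>_def unit_valued_def)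
  qed
  with solV show "optimality_solution G k \<phi> ?V"
    by (simp add: optimality_solution_def solves_optimality_equation_def)
  show "u n i g = ?V n i g" if u: "optimality_solution G k \<phi> u" and i: "i \<in> states G n - target G" for u n i g
  proof -
    have "solves_optimality_equation G k \<phi> u"
      using u by (auto simp: optimality_solution_def solves_optimality_equation_def unit_valued_def \<U>_def)
    from solution_eq_Fhat[OF G \<phi> this] i show ?thesis by auto
  qed
  have "?V n i g = T_mix G n k ((\<lambda>l. \<phi> l n i g)(k := \<phi>' n i g)) (?V (Suc n)) i g"
    if i: "i \<in> states G n - target G" for n i g
  proof -
    have "T_mix G n k ((\<lambda>l. \<phi> l n i g)(k := \<phi>' n i g)) (?V (Suc n)) i g =
        T_mix G n k ((\<lambda>l. \<phi> l n i g)(k := \<phi>' n i g)) (v k (Suc n)) i g"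
      by (rule T_mix_cong) (rule V)
    then show ?thesis by (simp only: V[OF i] att[OF i, symmetric])
  qed
  with \<phi>' show "\<exists>\<phi>'\<in>markov_kernels G k. \<forall>n. \<forall>i\<in>states G n - target G. \<forall>g.
      ?V n i g = T_mix G n k ((\<lambda>l. \<phi> l n i g)(k := \<phi>' n i g)) (?V (Suc n)) i g" by blast
qed

lemma ex_markov_kernel:
  assumes "valid_game G"
  shows "\<exists>\<phi>. \<forall>l. \<phi> l \<in> markov_kernels G l"
proof (intro exI allI)
  show "(\<lambda>n i g. return_pmf (SOME a. a \<in> avail G n l i)) \<in> markov_kernels G l" for l
    using valid_gameD(5)[OF assms] by (auto simp: markov_kernels_def probs_on_def some_in_eq)
qed

theorem ex_mutual_best_response:
  fixes G :: "('s, 'a, 'k::finite) game"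
  assumes G: "valid_game G" "assumption_A G"
  shows "\<exists>\<psi>. (\<forall>k. \<psi> k \<in> markov_kernels G k) \<and> mutual_best_response G \<psi>"
proof -
  obtain \<phi> :: "'k \<Rightarrow> ('s, 'a, 'k) markov_kernel" where \<phi>: "\<And>l. \<phi> l \<in> markov_kernels G l"
    using ex_markov_kernel[OF G(1)] by blast
  obtain \<psi> v where "\<forall>l. \<psi> l \<in> markov_kernels G l" "\<forall>k n. unit_valued G n (v k n)"
    and equilibrium: "\<forall>k\<in>UNIV. \<forall>n. \<forall>i\<in>states G n - target G. \<forall>g.
      v k n i g = T_mix G n k (\<lambda>l. \<psi> l n i g) (v k (Suc n)) i g \<and>
      (\<forall>b\<in>avail G n k i. T_mix G n k ((\<lambda>l. \<psi> l n i g)(k := return_pmf b)) (v k (Suc n)) i g \<le> v k n i g)"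
    using ex_equilibrium_values[OF G(1) \<phi>, of UNIV] by (elim exE conjE)
  then have \<psi>: "\<And>l. \<psi> l \<in> markov_kernels G l" and unit: "\<And>k n. unit_valued G n (v k n)"
    by simp_all
  note v = unit equilibrium[rule_format, OF UNIV_I, THEN conjunct1] equilibrium[rule_format, OF UNIV_I, THEN conjunct2, rule_format]
  have "mutual_best_response G \<psi>"
    unfolding mutual_best_response_def
  proof (intro allI ballI)
    fix n k i g assume i: "i \<in> states G n - target G"
    let ?V = "\<lambda>n i g. Fhat G n k i g (\<lambda>l. markov (\<psi> l))"
    have "solves_optimality_equation G k \<psi> (v k)"
      by (rule equilibrium_value_solves[OF G(1) \<psi> v])
    then have V: "?V n i g = v k n i g"
      using solution_eq_Fhat[OF G \<psi>] i by blast
    have F: "F G n k i g (\<lambda>l. markov (\<psi> l)) = v k n i g"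
      by (rule F_markov_eq[OF G \<psi> v(1,2) i])
    have "optimality_solution G k \<psi> ?V"
      by (rule optimality_equation(1)[OF G \<psi>])
    with i have "?V n i g = (SUP q\<in>probs_on (avail G n k i). T_mix G n k ((\<lambda>l. \<psi> l n i g)(k := q)) (?V (Suc n)) i g)"
      unfolding optimality_solution_def by blast
    with F V show "F G n k i g (\<lambda>l. markov (\<psi> l)) = ?V n i g \<and>
        ?V n i g = (SUP q\<in>probs_on (avail G n k i). T_mix G n k ((\<lambda>l. \<psi> l n i g)(k := q)) (?V (Suc n)) i g)"
      by simp
  qed
  with \<psi> show ?thesis by blast
qed

text \<open>
  At time \<open>0\<close> the supremum in \<open>Fhat\<close> ranges over all history-dependent policies, so mutual best responses
  form an equilibrium outside the target; in the target the outcome does not depend on the policies.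
\<close>

theorem mutual_best_response_imp_nash:
  assumes \<psi>: "\<And>k. \<psi> k \<in> markov_kernels G k" and best: "mutual_best_response G \<psi>"
  shows "nash_equilibrium G (\<lambda>k. markov (\<psi> k))"
  unfolding nash_equilibrium_def
proof (intro conjI ballI allI)
  show "(\<lambda>k. markov (\<psi> k)) \<in> multipolicies G"
    using \<psi> by (simp add: multipolicies_def markov_in_policies)
next
  fix i g k assume i: "i \<in> states G 0"
  let ?\<pi> = "\<lambda>k. markov (\<psi> k)"
  show "F G 0 k i g ?\<pi> = (SUP \<pi>'\<in>policies G k. F G 0 k i g (?\<pi>(k := \<pi>')))"
  proof (cases "i \<in> target G")
    case True
    then have "F G 0 k i g \<pi> = of_bool (g k \<le> 0)" for \<pi>
      by (simp add: F_eq_win_prob win_prob_target cur_state_def cur_goal_def)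
    moreover have "policies G k \<noteq> {}" using markov_in_policies[OF \<psi>[of k]] by blast
    ultimately show ?thesis by simp
  next
    case False
    with i best have "F G 0 k i g ?\<pi> = Fhat G 0 k i g ?\<pi>"
      unfolding mutual_best_response_def by blast
    then show ?thesis by (simp add: Fhat_def)
  qed
qed

theorem theorem2:
  fixes G :: "('s, 'a, 'k::finite) game"
  assumes "valid_game G" and "assumption_A G"
  shows
    "(\<forall>k \<phi>. (\<forall>l. \<phi> l \<in> markov_kernels G l) \<longrightarrow>
        optimality_solution G k \<phi> (\<lambda>n i g. Fhat G n k i g (\<lambda>l. markov (\<phi> l))) \<and>
        (\<forall>u. optimality_solution G k \<phi> u \<longrightarrow>
           (\<forall>n. \<forall>i\<in>states G n - target G. \<forall>g.
              u n i g = Fhat G n k i g (\<lambda>l. markov (\<phi> l)))) \<and>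
        (\<exists>\<phi>'\<in>markov_kernels G k. \<forall>n. \<forall>i\<in>states G n - target G. \<forall>g.
           Fhat G n k i g (\<lambda>l. markov (\<phi> l)) =
             T_mix G n k ((\<lambda>l. \<phi> l n i g)(k := \<phi>' n i g))
               (\<lambda>j g'. Fhat G (Suc n) k j g' (\<lambda>l. markov (\<phi> l))) i g)) \<and>
     (\<exists>\<psi>. (\<forall>k. \<psi> k \<in> markov_kernels G k) \<and> mutual_best_response G \<psi>) \<and>
     (\<forall>\<psi>. (\<forall>k. \<psi> k \<in> markov_kernels G k) \<and> mutual_best_response G \<psi> \<longrightarrow>
        nash_equilibrium G (\<lambda>k. markov (\<psi> k)))"
proof (intro conjI allI impI ballI)
  fix k and \<phi> :: "'k \<Rightarrow> ('s, 'a, 'k) markov_kernel" assume "\<forall>l. \<phi> l \<in> markov_kernels G l"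
  then have \<phi>: "\<And>l. \<phi> l \<in> markov_kernels G l" by blast
  show "optimality_solution G k \<phi> (\<lambda>n i g. Fhat G n k i g (\<lambda>l. markov (\<phi> l)))"
    by (rule optimality_equation(1)[OF assms \<phi>])
  show "u n i g = Fhat G n k i g (\<lambda>l. markov (\<phi> l))"
    if "optimality_solution G k \<phi> u" "i \<in> states G n - target G" for u n i g
    using that by (rule optimality_equation(2)[OF assms \<phi>])
  show "\<exists>\<phi>'\<in>markov_kernels G k. \<forall>n. \<forall>i\<in>states G n - target G. \<forall>g.
           Fhat G n k i g (\<lambda>l. markov (\<phi> l)) =
             T_mix G n k ((\<lambda>l. \<phi> l n i g)(k := \<phi>' n i g))
               (\<lambda>j g'. Fhat G (Suc n) k j g' (\<lambda>l. markov (\<phi> l))) i g"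
    by (rule optimality_equation(3)[OF assms \<phi>])
next
  show "\<exists>\<psi>. (\<forall>k. \<psi> k \<in> markov_kernels G k) \<and> mutual_best_response G \<psi>"
    by (rule ex_mutual_best_response[OF assms])
next
  show "nash_equilibrium G (\<lambda>k. markov (\<psi> k))"
    if "(\<forall>k. \<psi> k \<in> markov_kernels G k) \<and> mutual_best_response G \<psi>" for \<psi>
    using that by (intro mutual_best_response_imp_nash) blast+
qed

end
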